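(* Let $\mathcal{H}$ be a complex Hilbert space, let $T_1,T_2\in\mathcal{B}(\mathcal{H})$ be contractions and let $Q\in\mathcal{B}(\mathcal{H})$ be a unitary such that $T_2T_1=QT_1T_2$. Then there exist a Hilbert space $\mathcal{K}\supseteq\mathcal{H}$, isometries $V_1,V_2\in\mathcal{B}(\mathcal{K})$ and a unitary $\overline{Q}\in\mathcal{B}(\mathcal{K})$, with $\mathcal{H}$ reducing $\overline{Q}$ and $\overline{Q}|_{\mathcal{H}}=Q$, such that (i) $V_2V_1=\overline{Q}V_1V_2$; and (ii) $V_i$ is a lifting of $T_i$ for $i=1,2$, so that $T_1^nT_2^m=P_{\mathcal{H}}V_1^nV_2^m|_{\mathcal{H}}$ and $T_2^nT_1^m=P_{\mathcal{H}}V_2^nV_1^m|_{\mathcal{H}}$ for all integers $n,m\geq 0$. In fact, given any $q\in\mathbb{T}$, one can choose $\overline{Q}=Q\oplus qI_{\mathcal{K}\ominus\mathcal{H}}$.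
   Context: For Hilbert spaces $\mathcal{H}\subseteq\mathcal{K}$, an operator $S\in\mathcal{B}(\mathcal{K})$ is a lifting of $T\in\mathcal{B}(\mathcal{H})$ if $S(\mathcal{H}^\perp)\subseteq\mathcal{H}^\perp$ and $T=P_{\mathcal{H}}S|_{\mathcal{H}}$ (equivalently $S^*|_{\mathcal{H}}=T^*$). $P_{\mathcal{H}}$ is the orthogonal projection onto $\mathcal{H}$; $\mathbb{T}$ is the unit circle. *)

theory Defs
  imports "HOL-Analysis.Analysis"
begin

class complex_vector = real_vector +
  fixes scaleC :: "complex \<Rightarrow> 'a \<Rightarrow> 'a"
  assumes scaleC_add_right: "scaleC a (x + y) = scaleC a x + scaleC a y"
    and scaleC_add_left: "scaleC (a + b) x = scaleC a x + scaleC b x"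
    and scaleC_scaleC: "scaleC a (scaleC b x) = scaleC (a * b) x"
    and scaleC_one: "scaleC 1 x = x"
    and scaleR_scaleC: "scaleR r x = scaleC (complex_of_real r) x"

class complex_inner = complex_vector + real_normed_vector +
  fixes cinner :: "'a \<Rightarrow> 'a \<Rightarrow> complex"
  assumes cinner_commute: "cinner x y = cnj (cinner y x)"
    and cinner_add_left: "cinner (x + y) z = cinner x z + cinner y z"
    and cinner_scaleC_left: "cinner (scaleC c x) y = c * cinner x y"
    and cinner_ge_zero: "0 \<le> Re (cinner x x)"
    and cinner_eq_zero_iff: "cinner x x = 0 \<longleftrightarrow> x = 0"
    and norm_eq_sqrt_cinner: "norm x = sqrt (Re (cinner x x))"

text \<open>A complex Hilbert space is a type of class {complex_inner, complete_space}.\<close>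

definition bounded_op :: "('a::complex_inner \<Rightarrow> 'a) \<Rightarrow> bool" where
  "bounded_op T \<longleftrightarrow> bounded_linear T \<and> (\<forall>c x. T (scaleC c x) = scaleC c (T x))"

definition contraction :: "('a::complex_inner \<Rightarrow> 'a) \<Rightarrow> bool" where
  "contraction T \<longleftrightarrow> bounded_op T \<and> (\<forall>x. norm (T x) \<le> norm x)"

definition unitary_op :: "('a::complex_inner \<Rightarrow> 'a) \<Rightarrow> bool" where
  "unitary_op U \<longleftrightarrow> bounded_op U \<and> (\<forall>x. norm (U x) = norm x) \<and> surj U"

section \<open>The ambient Hilbert space l2(N, H) in which the dilation space K lives\<close>

definition l2 :: "(nat \<Rightarrow> 'a::complex_inner) set" where
  "l2 = {x. summable (\<lambda>n. (norm (x n))\<^sup>2)}"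

definition l2inner :: "(nat \<Rightarrow> 'a::complex_inner) \<Rightarrow> (nat \<Rightarrow> 'a) \<Rightarrow> complex" where
  "l2inner x y = (\<Sum>n. cinner (x n) (y n))"

definition l2norm :: "(nat \<Rightarrow> 'a::complex_inner) \<Rightarrow> real" where
  "l2norm x = sqrt (\<Sum>n. (norm (x n))\<^sup>2)"

text \<open>K is a closed (complex) subspace of l2(N,H); with the induced inner product it is a
  Hilbert space.\<close>
definition closed_subspace_l2 :: "(nat \<Rightarrow> 'a::complex_inner) set \<Rightarrow> bool" where
  "closed_subspace_l2 K \<longleftrightarrow>
     K \<subseteq> l2 \<and> (\<lambda>n. 0) \<in> K \<and>
     (\<forall>x\<in>K. \<forall>y\<in>K. (\<lambda>n. x n + y n) \<in> K) \<and>
     (\<forall>c. \<forall>x\<in>K. (\<lambda>n. scaleC c (x n)) \<in> K) \<and>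
     (\<forall>X x. (\<forall>k. X k \<in> K) \<and> x \<in> l2 \<and> (\<lambda>k. l2norm (\<lambda>n. X k n - x n)) \<longlonglongrightarrow> 0
        \<longrightarrow> x \<in> K)"

definition linear_on :: "(nat \<Rightarrow> 'a::complex_inner) set \<Rightarrow> ((nat \<Rightarrow> 'a) \<Rightarrow> (nat \<Rightarrow> 'a)) \<Rightarrow> bool" where
  "linear_on K V \<longleftrightarrow> V ` K \<subseteq> K \<and>
     (\<forall>x\<in>K. \<forall>y\<in>K. V (\<lambda>n. x n + y n) = (\<lambda>n. V x n + V y n)) \<and>
     (\<forall>c. \<forall>x\<in>K. V (\<lambda>n. scaleC c (x n)) = (\<lambda>n. scaleC c (V x n)))"

definition isometry_on :: "(nat \<Rightarrow> 'a::complex_inner) set \<Rightarrow> ((nat \<Rightarrow> 'a) \<Rightarrow> (nat \<Rightarrow> 'a)) \<Rightarrow> bool" where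
  "isometry_on K V \<longleftrightarrow> linear_on K V \<and> (\<forall>x\<in>K. l2norm (V x) = l2norm x)"

definition unitary_on :: "(nat \<Rightarrow> 'a::complex_inner) set \<Rightarrow> ((nat \<Rightarrow> 'a) \<Rightarrow> (nat \<Rightarrow> 'a)) \<Rightarrow> bool" where
  "unitary_on K U \<longleftrightarrow> isometry_on K U \<and> U ` K = K"

text \<open>H is identified with the subspace J(H) of K via an isometric linear embedding J.\<close>
definition embedding :: "(nat \<Rightarrow> 'a::complex_inner) set \<Rightarrow> ('a \<Rightarrow> (nat \<Rightarrow> 'a)) \<Rightarrow> bool" where
  "embedding K J \<longleftrightarrow> range J \<subseteq> K \<and>
     (\<forall>x y. J (x + y) = (\<lambda>n. J x n + J y n)) \<and>
     (\<forall>c x. J (scaleC c x) = (\<lambda>n. scaleC c (J x n))) \<and>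
     (\<forall>x y. l2inner (J x) (J y) = cinner x y)"

definition ocomp :: "(nat \<Rightarrow> 'a::complex_inner) set \<Rightarrow> ('a \<Rightarrow> (nat \<Rightarrow> 'a)) \<Rightarrow> (nat \<Rightarrow> 'a) set" where
  "ocomp K J = {k \<in> K. \<forall>h. l2inner k (J h) = 0}"

text \<open>compr_eq K J S T: T = P_H S|_H, i.e. for all h, h' in H,
  (T h, h') = (S h, h') (written out via the embedding J).\<close>
definition compr_eq :: "(nat \<Rightarrow> 'a::complex_inner) set \<Rightarrow> ('a \<Rightarrow> (nat \<Rightarrow> 'a)) \<Rightarrow>
    ((nat \<Rightarrow> 'a) \<Rightarrow> (nat \<Rightarrow> 'a)) \<Rightarrow> ('a \<Rightarrow> 'a) \<Rightarrow> bool" where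
  "compr_eq K J S T \<longleftrightarrow> (\<forall>h h'. cinner (T h) h' = l2inner (S (J h)) (J h'))"

definition lifting :: "(nat \<Rightarrow> 'a::complex_inner) set \<Rightarrow> ('a \<Rightarrow> (nat \<Rightarrow> 'a)) \<Rightarrow>
    ((nat \<Rightarrow> 'a) \<Rightarrow> (nat \<Rightarrow> 'a)) \<Rightarrow> ('a \<Rightarrow> 'a) \<Rightarrow> bool" where
  "lifting K J S T \<longleftrightarrow> S ` ocomp K J \<subseteq> ocomp K J \<and> compr_eq K J S T"

end

theory Submission
  imports Defs
begin

text \<open>As in Ando's theorem, let \<open>W\<^sub>i\<close> be the isometric lifting of \<open>T\<^sub>i\<close> on the direct sum of the
  space \<open>H\<close> and a sequence space over \<open>F\<close> given by \<open>(h, x\<^sub>0, x\<^sub>1, ...) \<mapsto> (T\<^sub>i h, D\<^sub>i h, x\<^sub>0, x\<^sub>1, ...)\<close>,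
  where \<open>D\<^sub>i : H \<rightarrow> F\<close> satisfies \<open>|D\<^sub>i h|\<^sup>2 = |h|\<^sup>2 - |T\<^sub>i h|\<^sup>2\<close>. The two products \<open>W\<^sub>1 W\<^sub>2\<close> and
  \<open>W\<^sub>2 W\<^sub>1\<close> shift by one pair of entries, and differ there by \<open>(D\<^sub>1 T\<^sub>2 h, D\<^sub>2 h)\<close> against
  \<open>(D\<^sub>2 T\<^sub>1 h, D\<^sub>1 h)\<close>, two vectors of the same norm because \<open>Q\<close> is unitary. If the ranges of \<open>D\<^sub>1\<close>
  and \<open>D\<^sub>2\<close> are orthogonal, so are those of the two maps to pairs, and a single reflection \<open>G\<close> carries
  \<open>(D\<^sub>1 T\<^sub>2 h, D\<^sub>2 h)\<close> to the multiple of \<open>(D\<^sub>2 T\<^sub>1 h, D\<^sub>1 h)\<close> by the conjugate of \<open>q\<close>; this replaces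
  the usual extension of a partial isometry by a dimension count. Let \<open>L\<close> act on the \<open>n\<close>-th pair as
  \<open>G\<close> times the \<open>n\<close>-th power of the conjugate of \<open>q\<close>. Then \<open>V\<^sub>1 = L W\<^sub>1\<close> and \<open>V\<^sub>2 = W\<^sub>2 L\<^sup>-\<^sup>1\<close>
  satisfy the twisted commutation relation with \<open>Q \<oplus> q\<close>. Everything is finally transported to the
  full space of square-summable sequences in \<open>H\<close>.\<close>

section \<open>Complex inner product spaces\<close>

lemma scaleC_zero_right [simp]: "scaleC c (0::'a::complex_vector) = 0"
  using scaleC_add_right[of c 0 "0::'a"] by simp

lemma scaleC_zero_left [simp]: "scaleC 0 (x::'a::complex_vector) = 0"
  using scaleC_add_left[of 0 0 x] by simp

lemma scaleC_minus_right: "scaleC c (- x) = - scaleC c (x::'a::complex_vector)"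
  using scaleC_add_right[of c x "- x"] by (simp add: eq_neg_iff_add_eq_0 add.commute)

lemma scaleC_diff_right: "scaleC c (x - y) = scaleC c x - scaleC c (y::'a::complex_vector)"
  using scaleC_add_right[of c x "- y"] by (simp add: scaleC_minus_right)

lemma scaleC_minus1: "scaleC (- 1) x = - (x::'a::complex_vector)"
  using scaleR_scaleC[of "- 1" x] by simp

lemma cinner_add_right:
  "cinner x (y + z) = cinner x y + cinner x (z::'a::complex_inner)"
  unfolding cinner_commute[of x "y + z"] cinner_commute[of x y] cinner_commute[of x z]
  by (simp add: cinner_add_left)

lemma cinner_scaleC_right:
  "cinner x (scaleC c y) = cnj c * cinner x (y::'a::complex_inner)"
  unfolding cinner_commute[of x "scaleC c y"] cinner_commute[of x y]
  by (simp add: cinner_scaleC_left)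

lemma cinner_zero_left [simp]: "cinner 0 (x::'a::complex_inner) = 0"
  using cinner_add_left[of 0 0 x] by simp

lemma cinner_zero_right [simp]: "cinner x (0::'a::complex_inner) = 0"
  using cinner_add_right[of x 0 0] by simp

lemma cinner_minus_left: "cinner (- x) y = - cinner x (y::'a::complex_inner)"
  using cinner_add_left[of x "- x" y] by (simp add: eq_neg_iff_add_eq_0 add.commute)

lemma cinner_minus_right: "cinner x (- y) = - cinner x (y::'a::complex_inner)"
  using cinner_add_right[of x y "- y"] by (simp add: eq_neg_iff_add_eq_0 add.commute)

lemma cinner_diff_left: "cinner (x - y) z = cinner x z - cinner y (z::'a::complex_inner)"
  using cinner_add_left[of x "- y" z] by (simp add: cinner_minus_left)

lemma cinner_diff_right: "cinner x (y - z) = cinner x y - cinner x (z::'a::complex_inner)"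
  using cinner_add_right[of x y "- z"] by (simp add: cinner_minus_right)

lemma Re_cinner_self: "Re (cinner x x) = (norm (x::'a::complex_inner))\<^sup>2"
  by (simp add: norm_eq_sqrt_cinner cinner_ge_zero)

lemma cinner_self: "cinner x x = complex_of_real ((norm (x::'a::complex_inner))\<^sup>2)"
  using cinner_commute[of x x] by (simp add: complex_eq_iff Re_cinner_self)

lemma cinner_eq_zero_sym: "cinner x y = 0 \<Longrightarrow> cinner y (x::'a::complex_inner) = 0"
  by (metis cinner_commute complex_cnj_zero)

lemma norm_add_square:
  "(norm (x + y))\<^sup>2 = (norm x)\<^sup>2 + (norm y)\<^sup>2 + 2 * Re (cinner x (y::'a::complex_inner))"
  using cinner_commute[of y x]
  by (simp add: Re_cinner_self[symmetric] cinner_add_left cinner_add_right)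

lemma norm_diff_square:
  "(norm (x - y))\<^sup>2 = (norm x)\<^sup>2 + (norm y)\<^sup>2 - 2 * Re (cinner x (y::'a::complex_inner))"
  using norm_add_square[of x "- y"] by (simp add: cinner_minus_right)

lemma norm_scaleC: "norm (scaleC c x) = cmod c * norm (x::'a::complex_inner)"
proof -
  have "cinner (scaleC c x) (scaleC c x) = (c * cnj c) * cinner x x"
    by (simp add: cinner_scaleC_left cinner_scaleC_right)
  also have "\<dots> = complex_of_real ((cmod c * norm x)\<^sup>2)"
    unfolding cinner_self complex_norm_square[symmetric] by (simp add: power_mult_distrib)
  finally have "(norm (scaleC c x))\<^sup>2 = (cmod c * norm x)\<^sup>2"
    by (metis Re_cinner_self Re_complex_of_real)
  then show ?thesis
    by (simp add: power2_eq_iff_nonneg)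
qed

text \<open>The triangle inequality belongs to the class of the norm, so expanding the square of
  \<open>norm (u + v)\<close> bounds the real part of the inner product. Rotating \<open>x\<close>
  by a unit scalar then turns the real part into the modulus.\<close>

lemma Cauchy_Schwarz_cinner: "cmod (cinner x y) \<le> norm x * norm (y::'a::complex_inner)"
proof -
  have re: "Re (cinner u v) \<le> norm u * norm v" for u v :: 'a
  proof -
    have "(norm (u + v))\<^sup>2 \<le> (norm u + norm v)\<^sup>2"
      by (simp add: norm_triangle_ineq power_mono)
    then show ?thesis
      unfolding norm_add_square power2_sum by simp
  qed
  show ?thesis
  proof (cases "cinner x y = 0")
    case False
    define c where "c = cnj (sgn (cinner x y))"
    have "cmod c = 1"
      using False by (simp add: c_def norm_sgn)
    moreover have "cinner (scaleC c x) y = cnj (cinner x y) * cinner x y / cmod (cinner x y)"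
      by (simp add: cinner_scaleC_left c_def sgn_eq)
    then have "cinner (scaleC c x) y = complex_of_real (cmod (cinner x y))"
      using False by (simp add: mult.commute[of "cnj _"] complex_norm_square[symmetric] power2_eq_square)
    ultimately show ?thesis
      using re[of "scaleC c x" y] by (simp add: norm_scaleC)
  qed simp
qed

lemma tendsto_cinner_left:
  assumes "(X \<longlongrightarrow> x) F"
  shows "((\<lambda>k. cinner (X k) (a::'a::complex_inner)) \<longlongrightarrow> cinner x a) F"
proof -
  have "((\<lambda>k. norm (X k - x) * norm a) \<longlongrightarrow> 0) F"
    using tendsto_mult_left_zero[OF tendsto_norm_zero[OF LIM_zero[OF assms]]] .
  then have "((\<lambda>k. cinner (X k - x) a) \<longlongrightarrow> 0) F"
    by (rule Lim_null_comparison[rotated]) (simp add: Cauchy_Schwarz_cinner)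
  then show ?thesis
    by (simp add: cinner_diff_left LIM_zero_iff)
qed

lemma closed_cinner_eq_zero:
  assumes "continuous_on UNIV f"
  shows "closed {x. cinner (f x) (a::'a::complex_inner) = 0}"
proof (rule closed_Collect_eq)
  show "continuous_on UNIV (\<lambda>x. cinner (f x) a)"
    using assms unfolding continuous_on_def by (blast intro: tendsto_cinner_left)
qed simp

section \<open>Complex-linear maps and polarization\<close>

definition clinear :: "('a::complex_vector \<Rightarrow> 'b::complex_vector) \<Rightarrow> bool" where
  "clinear f \<longleftrightarrow> (\<forall>x y. f (x + y) = f x + f y) \<and> (\<forall>c x. f (scaleC c x) = scaleC c (f x))"

lemma clinearI:
  "(\<And>x y. f (x + y) = f x + f y) \<Longrightarrow> (\<And>c x. f (scaleC c x) = scaleC c (f x)) \<Longrightarrow> clinear f"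
  by (simp add: clinear_def)

lemma clinear_add: "clinear f \<Longrightarrow> f (x + y) = f x + f y"
  by (simp add: clinear_def)

lemma clinear_scaleC: "clinear f \<Longrightarrow> f (scaleC c x) = scaleC c (f x)"
  by (simp add: clinear_def)

lemma clinear_zero: "clinear f \<Longrightarrow> f 0 = 0"
  using clinear_scaleC[of f 0 0] by simp

lemma clinear_diff: "clinear f \<Longrightarrow> f (x - y) = f x - f y"
  using clinear_add[of f "x - y" y] by (simp add: algebra_simps)

lemma clinear_compose: "clinear f \<Longrightarrow> clinear g \<Longrightarrow> clinear (\<lambda>x. f (g x))"
  by (simp add: clinear_def)

text \<open>Polarization: the norm of a sum determines the real part of the inner product, and
  replacing \<open>y\<close> by \<open>scaleC \<i> y\<close> recovers the imaginary part. The
  codomains may differ, so this also yields preservation of inner products by isometries.\<close>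

lemma cinner_eq_of_norm_eq:
  assumes "clinear A" "clinear B"
    and "\<And>x. norm (A x :: 'b::complex_inner) = norm (B x :: 'c::complex_inner)"
  shows "cinner (A x) (A y) = cinner (B x) (B y)"
proof -
  have re: "Re (cinner (A x) (A y)) = Re (cinner (B x) (B y))" for x y
    using norm_add_square[of "A x" "A y"] norm_add_square[of "B x" "B y"]
      assms(3)[of "x + y"] assms(3)[of x] assms(3)[of y]
    by (simp add: clinear_add[OF assms(1)] clinear_add[OF assms(2)])
  have "Im (cinner (A x) (A y)) = Im (cinner (B x) (B y))"
    using re[of x "scaleC \<i> y"]
    by (simp add: clinear_scaleC[OF assms(1)] clinear_scaleC[OF assms(2)] cinner_scaleC_right)
  with re show ?thesis
    by (simp add: complex_eq_iff)
qed

section \<open>Orthogonal projections and adjoints\<close>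

definition closed_csubspace :: "'a::complex_inner set \<Rightarrow> bool" where
  "closed_csubspace M \<longleftrightarrow> closed M \<and> 0 \<in> M \<and> (\<forall>x\<in>M. \<forall>y\<in>M. x + y \<in> M) \<and>
     (\<forall>c. \<forall>x\<in>M. scaleC c x \<in> M)"

lemma closed_csubspace_diff: "closed_csubspace M \<Longrightarrow> x \<in> M \<Longrightarrow> y \<in> M \<Longrightarrow> x - y \<in> M"
  unfolding closed_csubspace_def by (metis diff_conv_add_uminus scaleC_minus1)

lemma closed_csubspace_orthogonal: "closed_csubspace {x. \<forall>a\<in>S. cinner x a = 0}"
proof -
  have "{x. \<forall>a\<in>S. cinner x a = 0} = (\<Inter>a\<in>S. {x. cinner x a = 0})"
    by auto
  then have "closed {x. \<forall>a\<in>S. cinner x a = 0}"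
    by (simp only:) (intro closed_INT ballI closed_cinner_eq_zero continuous_on_id)
  then show ?thesis
    by (simp add: closed_csubspace_def cinner_add_left cinner_scaleC_left)
qed

text \<open>A variational argument: if the inner product \<open>w\<close> were nonzero, moving
  \<open>p\<close> along \<open>m\<close> by the small multiple \<open>t * w\<close> would bring it
  strictly closer to \<open>x\<close>.\<close>

lemma orthogonal_of_closest:
  fixes x p :: "'a::complex_inner"
  assumes M: "closed_csubspace M" and p: "p \<in> M" and min: "\<And>m. m \<in> M \<Longrightarrow> norm (x - p) \<le> norm (x - m)"
    and m: "m \<in> M"
  shows "cinner (x - p) m = 0"
proof (rule ccontr)
  define w where "w = cinner (x - p) m"
  \<comment> \<open>The summand 1 keeps the denominator positive without a case split and makes
    \<open>t * (norm m)\<^sup>2\<close> less than 1, so the linear gain outweighs the quadratic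
    loss.\<close>
  define t where "t = 1 / (1 + (norm m)\<^sup>2)"
  define c where "c = complex_of_real t * w"
  assume "cinner (x - p) m \<noteq> 0"
  then have w: "cmod w > 0"
    by (simp add: w_def)
  have t: "t > 0" "t * (norm m)\<^sup>2 < 1"
    by (simp_all add: t_def divide_simps add_pos_nonneg)
  have "p + scaleC c m \<in> M"
    using M p m by (simp add: closed_csubspace_def)
  then have "(norm (x - p))\<^sup>2 \<le> (norm ((x - p) - scaleC c m))\<^sup>2"
    using min by (simp add: power_mono diff_diff_eq)
  then have "2 * Re (cinner (x - p) (scaleC c m)) \<le> (norm (scaleC c m))\<^sup>2"
    by (simp add: norm_diff_square)
  moreover have "Re (cinner (x - p) (scaleC c m)) = t * (cmod w)\<^sup>2"
    by (simp add: cinner_scaleC_right w_def[symmetric] c_def mult.assoc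
        mult.commute[of "cnj w"] complex_norm_square[symmetric] flip: of_real_power)
  moreover have "(norm (scaleC c m))\<^sup>2 = (t * (norm m)\<^sup>2) * (t * (cmod w)\<^sup>2)"
    using t by (simp add: norm_scaleC c_def norm_mult power_mult_distrib power2_eq_square)
  ultimately have "2 * (t * (cmod w)\<^sup>2) \<le> (t * (norm m)\<^sup>2) * (t * (cmod w)\<^sup>2)"
    by simp
  moreover have pos: "t * (cmod w)\<^sup>2 > 0"
    using t w by simp
  ultimately show False
    using mult_strict_right_mono[OF t(2) pos] by linarith
qed

text \<open>Take a minimizing sequence for the squared distance, with slack \<open>r n\<close>.
  Midpoints stay in \<open>M\<close>, so the parallelogram law bounds the squared distance of two
  terms by twice the sum of their slacks. The sequence is therefore Cauchy, and its limit is a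
  closest point.\<close>

lemma projection_exists:
  fixes x :: "'a::{complex_inner, complete_space}"
  assumes M: "closed_csubspace M"
  shows "\<exists>p\<in>M. \<forall>m\<in>M. cinner (x - p) m = 0"
proof -
  define r where "r n = inverse (real (Suc n))" for n
  have r_pos: "r n > 0" for n
    by (simp add: r_def)
  define d where "d = (INF m\<in>M. (norm (x - m))\<^sup>2)"
  have ne: "M \<noteq> {}"
    using M by (auto simp: closed_csubspace_def)
  have bdd: "bdd_below ((\<lambda>m. (norm (x - m))\<^sup>2) ` M)"
    by (rule bdd_belowI[of _ 0]) auto
  have d_le: "d \<le> (norm (x - m))\<^sup>2" if "m \<in> M" for m
    unfolding d_def using bdd that by (rule cINF_lower)
  have "\<exists>m\<in>M. (norm (x - m))\<^sup>2 < d + r n" for n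
    using cINF_less_iff[OF ne bdd, of "d + r n"] r_pos[of n] by (simp add: d_def)
  then obtain X where XM: "\<And>n. X n \<in> M"
    and X: "\<And>n. (norm (x - X n))\<^sup>2 < d + r n"
    by metis
  have diff: "(norm (X k - X l))\<^sup>2 \<le> 2 * r k + 2 * r l" for k l
  proof -
    define u v where "u = x - X k" and "v = x - X l"
    have "scaleC (1/2) (X k + X l) \<in> M"
      using M XM by (simp add: closed_csubspace_def)
    moreover have "x - scaleC (1/2) (X k + X l) = (1/2) *\<^sub>R (u + v)"
    proof -
      have "scaleC (1/2) (X k + X l) = (1/2) *\<^sub>R (X k + X l)"
        by (simp add: scaleR_scaleC)
      moreover have "x = (1/2) *\<^sub>R (x + x)"
        by (simp add: scaleR_2[symmetric])
      ultimately show ?thesis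
        unfolding u_def v_def by (simp add: algebra_simps)
    qed
    ultimately have "4 * d \<le> (norm (u + v))\<^sup>2"
      using d_le by (fastforce simp: power_divide)
    moreover have "(norm (u - v))\<^sup>2 + (norm (u + v))\<^sup>2 = 2 * (norm u)\<^sup>2 + 2 * (norm v)\<^sup>2"
      by (simp add: norm_add_square norm_diff_square)
    moreover have "(norm (X k - X l))\<^sup>2 = (norm (u - v))\<^sup>2"
      by (simp add: u_def v_def norm_minus_commute)
    ultimately show ?thesis
      using X[of k, folded u_def] X[of l, folded v_def] by linarith
  qed
  have "Cauchy X"
  proof (rule metric_CauchyI)
    fix e :: real assume e: "e > 0"
    obtain N where N: "r N < e\<^sup>2 / 4"
      using reals_Archimedean[of "e\<^sup>2 / 4"] e by (auto simp: r_def)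
    have "dist (X k) (X l) < e" if "k \<ge> N" "l \<ge> N" for k l
    proof -
      have "r k \<le> r N" "r l \<le> r N"
        using that by (simp_all add: r_def divide_simps)
      then have "(norm (X k - X l))\<^sup>2 < e\<^sup>2"
        using diff[of k l] N by linarith
      then show ?thesis
        using e by (simp add: dist_norm power2_less_imp_less)
    qed
    then show "\<exists>N. \<forall>k\<ge>N. \<forall>l\<ge>N. dist (X k) (X l) < e"
      by blast
  qed
  then obtain p where p: "X \<longlonglongrightarrow> p"
    using Cauchy_convergent convergent_def by blast
  have pM: "p \<in> M"
    using M XM p by (auto simp: closed_csubspace_def closed_sequential_limits)
  have "(\<lambda>n. (norm (x - X n))\<^sup>2) \<longlonglongrightarrow> (norm (x - p))\<^sup>2"
    by (intro tendsto_intros p)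
  moreover have "(\<lambda>n. d + r n) \<longlonglongrightarrow> d + 0"
    unfolding r_def by (intro tendsto_add tendsto_const LIMSEQ_inverse_real_of_nat)
  ultimately have "(norm (x - p))\<^sup>2 \<le> d + 0"
    using X by (intro LIMSEQ_le) (auto intro: less_imp_le)
  then have "(norm (x - p))\<^sup>2 \<le> (norm (x - m))\<^sup>2" if "m \<in> M" for m
    using d_le[OF that] by linarith
  then have "norm (x - p) \<le> norm (x - m)" if "m \<in> M" for m
    using that by (meson power2_le_imp_le norm_ge_zero)
  then show ?thesis
    using orthogonal_of_closest[OF M pM] pM by blast
qed

definition cproj :: "'a::complex_inner set \<Rightarrow> 'a \<Rightarrow> 'a" where
  "cproj M x = (SOME p. p \<in> M \<and> (\<forall>m\<in>M. cinner (x - p) m = 0))"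

context
  fixes M :: "'a::{complex_inner, complete_space} set"
  assumes M: "closed_csubspace M"
begin

lemma cproj_in: "cproj M x \<in> M"
  and cproj_orthogonal: "m \<in> M \<Longrightarrow> cinner (x - cproj M x) m = 0"
  using someI_ex[of "\<lambda>p. p \<in> M \<and> (\<forall>m\<in>M. cinner (x - p) m = 0)"] projection_exists[OF M, of x]
  unfolding cproj_def by blast+

lemma cproj_unique:
  assumes "p \<in> M" "\<And>m. m \<in> M \<Longrightarrow> cinner (x - p) m = 0"
  shows "cproj M x = p"
proof -
  define e where "e = p - cproj M x"
  have "e \<in> M"
    unfolding e_def using M assms(1) cproj_in by (rule closed_csubspace_diff)
  then have "cinner ((x - cproj M x) - (x - p)) e = 0"
    unfolding cinner_diff_left[of "x - cproj M x"] by (simp add: cproj_orthogonal assms(2))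
  moreover have "(x - cproj M x) - (x - p) = e"
    by (simp add: e_def)
  ultimately have "cinner e e = 0"
    by simp
  then show ?thesis
    by (simp add: cinner_eq_zero_iff e_def)
qed

lemma clinear_cproj: "clinear (cproj M)"
proof (rule clinearI)
  have mem: "cproj M x + cproj M y \<in> M" "scaleC c (cproj M x) \<in> M" for x y c
    using M cproj_in by (simp_all add: closed_csubspace_def)
  show "cproj M (x + y) = cproj M x + cproj M y" for x y
  proof (rule cproj_unique)
    fix m assume "m \<in> M"
    then have "cinner ((x - cproj M x) + (y - cproj M y)) m = 0"
      by (simp add: cinner_add_left[of "x - cproj M x"] cproj_orthogonal)
    then show "cinner (x + y - (cproj M x + cproj M y)) m = 0"
      by (simp add: algebra_simps)
  qed (rule mem)
  show "cproj M (scaleC c x) = scaleC c (cproj M x)" for c x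
  proof (rule cproj_unique)
    fix m assume "m \<in> M"
    then have "cinner (scaleC c (x - cproj M x)) m = 0"
      by (simp add: cinner_scaleC_left cproj_orthogonal)
    then show "cinner (scaleC c x - scaleC c (cproj M x)) m = 0"
      by (simp add: scaleC_diff_right)
  qed (rule mem)
qed

end

section \<open>Adjoints of contractions\<close>

lemma contraction_clinear: "contraction T \<Longrightarrow> clinear T"
  by (simp add: contraction_def bounded_op_def clinear_def linear_add bounded_linear.linear)

lemma contraction_norm_le: "contraction T \<Longrightarrow> norm (T x) \<le> norm x"
  by (simp add: contraction_def)

text \<open>The Riesz representation of the functional sending \<open>x\<close> to
  \<open>cinner (T x) y\<close>, for each fixed \<open>y\<close>; the representing vectors form the
  adjoint.\<close>

lemma contraction_adjoint_exists:
  fixes T :: "'a::{complex_inner, complete_space} \<Rightarrow> 'a"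
  assumes T: "contraction T"
  shows "\<exists>S. \<forall>x y. cinner (T x) y = cinner x (S y)"
proof -
  have lin: "clinear T"
    using T by (rule contraction_clinear)
  have bl: "bounded_linear T"
    using T by (simp add: contraction_def bounded_op_def)
  have "\<exists>z. \<forall>x. cinner (T x) y = cinner x z" for y
  proof (cases "\<forall>x. cinner (T x) y = 0")
    case True
    then show ?thesis
      by (intro exI[of _ 0]) simp
  next
    case False
    define M where "M = {x. cinner (T x) y = 0}"
    have "closed M"
      unfolding M_def
      by (intro closed_cinner_eq_zero linear_continuous_on bl)
    then have M: "closed_csubspace M"
      using clinear_zero[OF lin] clinear_add[OF lin] clinear_scaleC[OF lin]
      by (simp add: closed_csubspace_def M_def cinner_add_left cinner_scaleC_left)
    from False obtain x0 where x0: "cinner (T x0) y \<noteq> 0"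
      by blast
    \<comment> \<open>\<open>u\<close> is orthogonal to the kernel \<open>M\<close> of the
      functional and spans a complement of it: subtracting \<open>scaleC (f x / f u) u\<close> from
      any \<open>x\<close> lands in \<open>M\<close>. This forces the scalar in \<open>z\<close>
      below.\<close>
    define u where "u = x0 - cproj M x0"
    define f where "f x = cinner (T x) y" for x
    have "cinner (T (cproj M x0)) y = 0"
      using cproj_in[OF M, of x0] by (simp add: M_def)
    then have fu: "f u \<noteq> 0"
      using x0 by (simp add: f_def u_def clinear_diff[OF lin] cinner_diff_left)
    then have u: "u \<noteq> 0"
      using clinear_zero[OF lin] by (auto simp: f_def)
    define z where "z = scaleC (cnj (f u) / (norm u)\<^sup>2) u"
    have "f x = cinner x z" for x
    proof -
      have "x - scaleC (f x / f u) u \<in> M"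
        using fu by (simp add: M_def clinear_diff[OF lin] clinear_scaleC[OF lin]
            cinner_diff_left cinner_scaleC_left f_def)
      then have "cinner u (x - scaleC (f x / f u) u) = 0"
        unfolding u_def by (rule cproj_orthogonal[OF M])
      then have "cinner (x - scaleC (f x / f u) u) u = 0"
        by (rule cinner_eq_zero_sym)
      then have "cinner x u = f x / f u * (norm u)\<^sup>2"
        by (simp add: cinner_diff_left cinner_scaleC_left cinner_self)
      then show ?thesis
        using fu u by (simp add: z_def cinner_scaleC_right)
    qed
    then show ?thesis
      by (auto simp: f_def)
  qed
  then show ?thesis
    by metis
qed

text \<open>\<open>A\<close> and \<open>B\<close> induce the same inner products and have mutually
  orthogonal ranges, so every \<open>A h + B h\<close> is orthogonal to every
  \<open>A g - B g\<close>. The reflection \<open>2 P - 1\<close> in the orthogonal complement of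
  the differences fixes the sums and negates the differences, hence exchanges \<open>A h\<close> and
  \<open>B h\<close>.\<close>

lemma reflection_exists:
  fixes A B :: "'h::complex_vector \<Rightarrow> 'e::{complex_inner, complete_space}"
  assumes "clinear A" "clinear B" and norm_eq: "\<And>h. norm (A h) = norm (B h)"
    and orth: "\<And>g h. cinner (A g) (B h) = 0"
  shows "\<exists>G. clinear G \<and> (\<forall>z. norm (G z) = norm z) \<and> (\<forall>z. G (G z) = z) \<and> (\<forall>h. G (A h) = B h)"
proof -
  define M where "M = {z. \<forall>a\<in>range (\<lambda>h. A h - B h). cinner z a = 0}"
  define P where "P = cproj M"
  define G where "G z = (P z + P z) - z" for z
  have M: "closed_csubspace M"
    unfolding M_def by (rule closed_csubspace_orthogonal)
  note lin = clinear_cproj[OF M, folded P_def]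
  have PP: "P (P z) = P z" for z
    unfolding P_def by (rule cproj_unique[OF M]) (simp_all add: cproj_in[OF M])
  have linG: "clinear G"
    by (rule clinearI)
      (simp_all add: G_def clinear_add[OF lin] clinear_scaleC[OF lin] scaleC_add_right
        scaleC_diff_right algebra_simps)
  have "(norm (G z))\<^sup>2 = (norm z)\<^sup>2" for z
  proof -
    have "cinner (z - P z) (P z) = 0"
      unfolding P_def by (rule cproj_orthogonal[OF M cproj_in[OF M]])
    then have "cinner (P z) (z - P z) = 0"
      by (rule cinner_eq_zero_sym)
    moreover have "G z = P z - (z - P z)" "z = P z + (z - P z)"
      by (simp_all add: G_def)
    ultimately show ?thesis
      by (metis norm_add_square norm_diff_square diff_zero add_0_right mult_zero_right zero_complex.sel(1))
  qed
  then have "norm (G z) = norm z" for z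
    by (simp add: power2_eq_iff_nonneg)
  moreover have "G (G z) = z" for z
    by (simp add: G_def clinear_add[OF lin] clinear_diff[OF lin] PP)
  moreover have "G (A h) = B h" for h
  proof -
    have "cinner (A h + B h) (A g - B g) = 0" for g
      using cinner_eq_of_norm_eq[OF assms(1,2) norm_eq, of h g] orth cinner_eq_zero_sym[OF orth]
      by (simp add: cinner_add_left cinner_diff_right)
    then have "A h + B h \<in> M"
      by (auto simp: M_def)
    then have sum: "P (A h + B h) = A h + B h"
      unfolding P_def by (intro cproj_unique[OF M]) simp_all
    have "P (A h - B h) = 0"
      unfolding P_def
    proof (rule cproj_unique[OF M])
      show "0 \<in> M"
        using M by (simp add: closed_csubspace_def)
      show "cinner (A h - B h - 0) m = 0" if "m \<in> M" for m
        using that by (auto simp: M_def intro: cinner_eq_zero_sym)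
    qed
    then have "P (A h) + P (A h) = A h + B h"
      using sum by (simp add: clinear_add[OF lin] clinear_diff[OF lin])
    then show ?thesis
      by (simp add: G_def)
  qed
  ultimately show ?thesis
    using linG by blast
qed

section \<open>Direct sums\<close>

instantiation prod :: (complex_vector, complex_vector) complex_vector
begin

definition scaleC_prod_def: "scaleC c p = (scaleC c (fst p), scaleC c (snd p))"

instance
  by standard
    (simp_all add: scaleC_prod_def scaleC_add_right scaleC_add_left scaleC_scaleC scaleC_one
      scaleR_prod_def scaleR_scaleC)

end

lemma fst_scaleC [simp]: "fst (scaleC c p) = scaleC c (fst p)"
  and snd_scaleC [simp]: "snd (scaleC c p) = scaleC c (snd p)"
  by (simp_all add: scaleC_prod_def)

lemma scaleC_Pair: "scaleC c (x, y) = (scaleC c x, scaleC c y)"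
  by (simp add: scaleC_prod_def)

lemma norm_prod_square: "(norm p)\<^sup>2 = (norm (fst p))\<^sup>2 + (norm (snd p))\<^sup>2"
  by (simp add: norm_prod_def)

text \<open>The norm that pairs already carry is the Euclidean one, so it is the norm of the inner
  product of the orthogonal sum.\<close>

instantiation prod :: (complex_inner, complex_inner) complex_inner
begin

definition cinner_prod_def: "cinner p q = cinner (fst p) (fst q) + cinner (snd p) (snd q)"

instance
proof
  fix x y z :: "'a \<times> 'b" and c :: complex
  show "cinner x y = cnj (cinner y x)"
    unfolding cinner_prod_def complex_cnj_add
    by (simp only: cinner_commute[symmetric])
  show "cinner (x + y) z = cinner x z + cinner y z"
    by (simp add: cinner_prod_def cinner_add_left)
  show "cinner (scaleC c x) y = c * cinner x y"
    by (simp add: cinner_prod_def cinner_scaleC_left distrib_left)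
  have self: "cinner x x = complex_of_real ((norm x)\<^sup>2)"
    by (simp add: cinner_prod_def cinner_self norm_prod_square del: of_real_power)
  then show "0 \<le> Re (cinner x x)" and "cinner x x = 0 \<longleftrightarrow> x = 0"
    and "norm x = sqrt (Re (cinner x x))"
    by (simp_all del: of_real_power)
qed

end

section \<open>Square-summable sequences\<close>

lemma l2_I: "(\<lambda>n. (norm (x n))\<^sup>2) sums s \<Longrightarrow> x \<in> l2"
  by (auto simp: l2_def summable_def)

lemma l2_zero: "(\<lambda>n. 0) \<in> l2"
  by (simp add: l2_def)

lemma l2_add:
  assumes "x \<in> l2" "y \<in> l2"
  shows "(\<lambda>n. x n + y n) \<in> l2"
  unfolding l2_def mem_Collect_eq
proof (rule summable_comparison_test_ev[OF always_eventually])
  show "summable (\<lambda>n. 2 * (norm (x n))\<^sup>2 + 2 * (norm (y n))\<^sup>2)"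
    using assms unfolding l2_def by (auto intro!: summable_add summable_mult)
  have "(norm (x n + y n))\<^sup>2 + (norm (x n - y n))\<^sup>2 = 2 * (norm (x n))\<^sup>2 + 2 * (norm (y n))\<^sup>2" for n
    by (simp add: norm_add_square norm_diff_square)
  then have "(norm (x n + y n))\<^sup>2 \<le> 2 * (norm (x n))\<^sup>2 + 2 * (norm (y n))\<^sup>2" for n
    by (smt (verit) zero_le_power2)
  then show "\<forall>n. norm ((norm (x n + y n))\<^sup>2) \<le> 2 * (norm (x n))\<^sup>2 + 2 * (norm (y n))\<^sup>2"
    by simp
qed

lemma l2_scaleC: "x \<in> l2 \<Longrightarrow> (\<lambda>n. scaleC c (x n)) \<in> l2"
  by (simp add: l2_def norm_scaleC power_mult_distrib summable_mult)

lemma l2_diff: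
  assumes "x \<in> l2" "y \<in> l2"
  shows "(\<lambda>n. x n - y n) \<in> l2"
  using l2_add[OF assms(1) l2_scaleC[OF assms(2), of "- 1"]] by (simp add: scaleC_minus1)

lemma l2_summable_cinner:
  assumes "x \<in> l2" "y \<in> l2"
  shows "summable (\<lambda>n. cinner (x n) (y n))"
proof (rule summable_comparison_test_ev[OF always_eventually])
  show "summable (\<lambda>n. (norm (x n))\<^sup>2 + (norm (y n))\<^sup>2)"
    using assms unfolding l2_def by (auto intro!: summable_add)
  have "norm (x n) * norm (y n) \<le> (norm (x n))\<^sup>2 + (norm (y n))\<^sup>2" for n
    using sum_squares_bound[of "norm (x n)" "norm (y n)"]
      mult_nonneg_nonneg[OF norm_ge_zero[of "x n"] norm_ge_zero[of "y n"]] by linarith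
  then show "\<forall>n. norm (cinner (x n) (y n)) \<le> (norm (x n))\<^sup>2 + (norm (y n))\<^sup>2"
    using Cauchy_Schwarz_cinner order_trans by blast
qed

section \<open>Square-summable sequences as a Hilbert space type\<close>

typedef (overloaded) 'a ell2 = "l2 :: (nat \<Rightarrow> 'a::complex_inner) set"
  morphisms coord Abs_ell2
  using l2_zero by blast

lemma coord_Abs_ell2: "x \<in> l2 \<Longrightarrow> coord (Abs_ell2 x) = x"
  by (rule Abs_ell2_inverse)

lemma ell2_eqI: "(\<And>n. coord x n = coord y n) \<Longrightarrow> x = y"
  by (metis coord_inject ext)

instantiation ell2 :: (complex_inner) complex_vector
begin

definition zero_ell2_def: "0 = Abs_ell2 (\<lambda>n. 0)"
definition plus_ell2_def: "x + y = Abs_ell2 (\<lambda>n. coord x n + coord y n)"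
definition minus_ell2_def: "x - y = Abs_ell2 (\<lambda>n. coord x n - coord y n)"
definition uminus_ell2_def: "- x = Abs_ell2 (\<lambda>n. scaleC (- 1) (coord x n))"
definition scaleC_ell2_def: "scaleC c x = Abs_ell2 (\<lambda>n. scaleC c (coord x n))"
definition scaleR_ell2_def: "r *\<^sub>R (x :: 'a ell2) = scaleC (complex_of_real r) x"

lemma coord_zero: "coord 0 n = 0"
  by (simp add: zero_ell2_def coord_Abs_ell2 l2_zero)

lemma coord_plus: "coord (x + y) n = coord x n + coord y n"
  by (simp add: plus_ell2_def coord_Abs_ell2 l2_add coord)

lemma coord_minus: "coord (x - y) n = coord x n - coord y n"
  by (simp add: minus_ell2_def coord_Abs_ell2 l2_diff coord)

lemma coord_scaleC: "coord (scaleC c x) n = scaleC c (coord x n)"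
  by (simp add: scaleC_ell2_def coord_Abs_ell2 l2_scaleC coord)

lemma coord_uminus: "coord (- x) n = - coord x n"
  by (simp add: uminus_ell2_def coord_Abs_ell2 l2_scaleC coord scaleC_minus1[symmetric])

instance
proof
  fix x y z :: "'a ell2" and a b :: real and c d :: complex
  note coords = coord_zero coord_plus coord_minus coord_scaleC coord_uminus
  show "x + y + z = x + (y + z)" "x + y = y + x" "0 + x = x" "- x + x = 0" "x - y = x + - y"
    by (rule ell2_eqI, simp add: coords algebra_simps)+
  show "scaleC c (x + y) = scaleC c x + scaleC c y" "scaleC (c + d) x = scaleC c x + scaleC d x"
    "scaleC c (scaleC d x) = scaleC (c * d) x" "scaleC 1 x = x"
    by (rule ell2_eqI, simp add: coords scaleC_add_right scaleC_add_left scaleC_scaleC scaleC_one)+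
  show "a *\<^sub>R x = scaleC (complex_of_real a) x"
    by (rule scaleR_ell2_def)
  show "a *\<^sub>R (x + y) = a *\<^sub>R x + a *\<^sub>R y" "(a + b) *\<^sub>R x = a *\<^sub>R x + b *\<^sub>R x"
    "a *\<^sub>R b *\<^sub>R x = (a * b) *\<^sub>R x" "1 *\<^sub>R x = x"
    by (rule ell2_eqI, simp add: scaleR_ell2_def coords scaleC_add_right scaleC_add_left
        scaleC_scaleC scaleC_one)+
qed

end

text \<open>Norm and inner product are \<open>l2norm\<close> and \<open>l2inner\<close> of the
  coordinates, so facts about this type translate directly into the notions of the theorem.\<close>

instantiation ell2 :: (complex_inner) complex_inner
begin

definition norm_ell2_def: "norm x = l2norm (coord x)"
definition dist_ell2_def: "dist x (y :: 'a ell2) = norm (x - y)"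
definition sgn_ell2_def: "sgn (x :: 'a ell2) = x /\<^sub>R norm x"
definition uniformity_ell2_def:
  "(uniformity :: ('a ell2 \<times> 'a ell2) filter) = (INF e\<in>{0<..}. principal {(x, y). dist x y < e})"
definition open_ell2_def:
  "open (U :: 'a ell2 set) \<longleftrightarrow> (\<forall>x\<in>U. eventually (\<lambda>(x', y). x' = x \<longrightarrow> y \<in> U) uniformity)"
definition cinner_ell2_def: "cinner x y = l2inner (coord x) (coord y)"

lemma ell2_norm_sums: "(\<lambda>n. (norm (coord x n))\<^sup>2) sums (norm x)\<^sup>2"
proof -
  have "summable (\<lambda>n. (norm (coord x n))\<^sup>2)"
    using coord[of x] by (simp add: l2_def)
  then show ?thesis
    by (simp add: norm_ell2_def l2norm_def suminf_nonneg summable_sums)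
qed

lemma ell2_cinner_sums: "(\<lambda>n. cinner (coord x n) (coord y n)) sums cinner x y"
  unfolding cinner_ell2_def l2inner_def by (intro summable_sums l2_summable_cinner coord)

text \<open>Minkowski's inequality for the finite sections, followed by passage to the
  limit.\<close>

lemma ell2_norm_triangle: "norm (x + y) \<le> norm x + norm (y :: 'a ell2)"
proof -
  have le: "L2_set (\<lambda>n. norm (coord z n)) {..<N} \<le> norm z" for z :: "'a ell2" and N
    unfolding L2_set_def norm_ell2_def l2norm_def
    using coord[of z] by (intro real_sqrt_le_mono sum_le_suminf) (auto simp: l2_def)
  have "(\<Sum>n<N. (norm (coord (x + y) n))\<^sup>2) \<le> (norm x + norm y)\<^sup>2" for N
  proof (rule real_sqrt_le_iff[THEN iffD1])
    have "sqrt (\<Sum>n<N. (norm (coord (x + y) n))\<^sup>2) = L2_set (\<lambda>n. norm (coord x n + coord y n)) {..<N}"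
      by (simp add: L2_set_def coord_plus)
    also have "\<dots> \<le> L2_set (\<lambda>n. norm (coord x n) + norm (coord y n)) {..<N}"
      by (intro L2_set_mono norm_triangle_ineq norm_ge_zero)
    also have "\<dots> \<le> L2_set (\<lambda>n. norm (coord x n)) {..<N} + L2_set (\<lambda>n. norm (coord y n)) {..<N}"
      by (rule L2_set_triangle_ineq)
    also have "\<dots> \<le> norm x + norm y"
      by (intro add_mono le)
    also have "\<dots> \<le> sqrt ((norm x + norm y)\<^sup>2)"
      by simp
    finally show "sqrt (\<Sum>n<N. (norm (coord (x + y) n))\<^sup>2) \<le> sqrt ((norm x + norm y)\<^sup>2)" .
  qed
  then have "(norm (x + y))\<^sup>2 \<le> (norm x + norm y)\<^sup>2"
    using ell2_norm_sums[of "x + y"] by (intro LIMSEQ_le_const2) (auto simp: sums_def)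
  moreover have "0 \<le> norm x + norm y"
    by (simp add: norm_ell2_def l2norm_def suminf_nonneg coord[unfolded l2_def, simplified])
  ultimately show ?thesis
    by (rule power2_le_imp_le)
qed

instance
proof
  fix x y z :: "'a ell2" and a :: real and c :: complex
  show "dist x y = norm (x - y)"
    by (rule dist_ell2_def)
  show "sgn x = x /\<^sub>R norm x"
    by (rule sgn_ell2_def)
  show "(uniformity :: ('a ell2 \<times> 'a ell2) filter) = (INF e\<in>{0<..}. principal {(x, y). dist x y < e})"
    by (rule uniformity_ell2_def)
  show "open U \<longleftrightarrow> (\<forall>x\<in>U. eventually (\<lambda>(x', y). x' = x \<longrightarrow> y \<in> U) uniformity)" for U :: "'a ell2 set"
    by (rule open_ell2_def)
  have nonneg: "0 \<le> norm x"
    by (simp add: norm_ell2_def l2norm_def suminf_nonneg coord[unfolded l2_def, simplified])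
  show norm_zero: "norm x = 0 \<longleftrightarrow> x = 0"
  proof
    assume "norm x = 0"
    then have "(\<lambda>n. (norm (coord x n))\<^sup>2) sums 0"
      using ell2_norm_sums[of x] by simp
    then have "\<forall>n. (norm (coord x n))\<^sup>2 = 0"
      using suminf_eq_zero_iff[of "\<lambda>n. (norm (coord x n))\<^sup>2"] by (auto simp: sums_iff)
    then show "x = 0"
      by (intro ell2_eqI) (simp add: coord_zero)
  next
    assume "x = 0"
    then show "norm x = 0"
      by (simp add: norm_ell2_def l2norm_def coord_zero)
  qed
  show "norm (x + y) \<le> norm x + norm y"
    by (rule ell2_norm_triangle)
  have "norm (a *\<^sub>R x) = sqrt (\<bar>a\<bar>\<^sup>2 * (\<Sum>n. (norm (coord x n))\<^sup>2))"
    unfolding norm_ell2_def l2norm_def scaleR_ell2_def coord_scaleC norm_scaleC power_mult_distrib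
      norm_of_real
    by (subst suminf_mult) (use coord[of x] in \<open>simp_all add: l2_def\<close>)
  then show "norm (a *\<^sub>R x) = \<bar>a\<bar> * norm x"
    by (simp add: real_sqrt_mult norm_ell2_def l2norm_def)
  show "cinner x y = cnj (cinner y x)"
  proof -
    have "(\<lambda>n. cnj (cinner (coord y n) (coord x n))) sums cnj (cinner y x)"
      unfolding sums_cnj by (rule ell2_cinner_sums)
    then have "(\<lambda>n. cinner (coord x n) (coord y n)) sums cnj (cinner y x)"
      by (simp only: cinner_commute[symmetric])
    then show ?thesis
      using ell2_cinner_sums sums_unique2 by blast
  qed
  show "cinner (x + y) z = cinner x z + cinner y z"
    using sums_unique2[OF ell2_cinner_sums[of "x + y" z]]
      sums_add[OF ell2_cinner_sums[of x z] ell2_cinner_sums[of y z]]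
    by (simp add: coord_plus cinner_add_left)
  show "cinner (scaleC c x) y = c * cinner x y"
    using sums_unique2[OF ell2_cinner_sums[of "scaleC c x" y]] sums_mult[OF ell2_cinner_sums[of x y], of c]
    by (simp add: coord_scaleC cinner_scaleC_left)
  have self: "cinner x x = complex_of_real ((norm x)\<^sup>2)"
    using sums_unique2[OF ell2_cinner_sums[of x x]] sums_of_real[OF ell2_norm_sums[of x], where 'a=complex]
    by (simp add: cinner_self)
  show "0 \<le> Re (cinner x x)" "cinner x x = 0 \<longleftrightarrow> x = 0" "norm x = sqrt (Re (cinner x x))"
    using norm_zero nonneg by (simp_all add: self del: of_real_power)
qed

end

lemma norm_Abs_ell2:
  assumes "(\<lambda>n. (norm (f n))\<^sup>2) sums s"
  shows "(norm (Abs_ell2 f))\<^sup>2 = s"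
  using sums_unique2[OF ell2_norm_sums[of "Abs_ell2 f"]] assms
  by (simp add: coord_Abs_ell2[OF l2_I[OF assms]])

lemma norm_coord_le: "norm (coord x n) \<le> norm x"
proof -
  have "(norm (coord x n))\<^sup>2 \<le> (norm x)\<^sup>2"
    using sum_le_suminf[of "\<lambda>n. (norm (coord x n))\<^sup>2" "{n}"] ell2_norm_sums[of x]
    by (simp add: sums_iff)
  then show ?thesis
    by (simp add: power2_le_iff_abs_le)
qed

text \<open>Completeness is what allows orthogonal projections, and thus the reflection, on pairs of
  sequences. The limit is formed coordinatewise; bounds on finite partial sums survive the limit and
  then control the whole series.\<close>

instance ell2 :: ("{complex_inner, complete_space}") complete_space
proof
  fix X :: "nat \<Rightarrow> 'a ell2"
  assume X: "Cauchy X"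
  have "\<exists>l. (\<lambda>k. coord (X k) n) \<longlonglongrightarrow> l" for n
  proof -
    have "norm (coord (X k) n - coord (X l) n) \<le> norm (X k - X l)" for k l
      using norm_coord_le[of "X k - X l" n] by (simp add: coord_minus)
    then have "Cauchy (\<lambda>k. coord (X k) n)"
      using X unfolding Cauchy_iff by (meson le_less_trans)
    then show ?thesis
      using Cauchy_convergent convergent_def by blast
  qed
  then obtain L where L: "\<And>n. (\<lambda>k. coord (X k) n) \<longlonglongrightarrow> L n"
    by metis
  \<comment> \<open>One estimate serves twice: a single \<open>k\<close> shows that \<open>L\<close>
    is square-summable, and all large \<open>k\<close> give convergence in norm.\<close>
  have tail: "\<exists>N. \<forall>k\<ge>N. (\<lambda>n. coord (X k) n - L n) \<in> l2 \<and>
      l2norm (\<lambda>n. coord (X k) n - L n) \<le> e" if e: "e > 0" for e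
  proof -
    obtain N where N: "\<And>k l. k \<ge> N \<Longrightarrow> l \<ge> N \<Longrightarrow> norm (X k - X l) < e"
      using X e unfolding Cauchy_iff by meson
    have "(\<lambda>n. coord (X k) n - L n) \<in> l2 \<and> l2norm (\<lambda>n. coord (X k) n - L n) \<le> e" if k: "k \<ge> N" for k
    proof -
      have part: "(\<Sum>n<m. (norm (coord (X k) n - L n))\<^sup>2) \<le> e\<^sup>2" for m
      proof (rule LIMSEQ_le_const2)
        show "(\<lambda>l. \<Sum>n<m. (norm (coord (X k) n - coord (X l) n))\<^sup>2)
          \<longlonglongrightarrow> (\<Sum>n<m. (norm (coord (X k) n - L n))\<^sup>2)"
          by (intro tendsto_intros L)
        have "(\<Sum>n<m. (norm (coord (X k) n - coord (X l) n))\<^sup>2) \<le> e\<^sup>2" if "l \<ge> N" for l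
        proof -
          have "(\<Sum>n<m. (norm (coord (X k - X l) n))\<^sup>2) \<le> (norm (X k - X l))\<^sup>2"
            using sum_le_suminf[of "\<lambda>n. (norm (coord (X k - X l) n))\<^sup>2" "{..<m}"]
              ell2_norm_sums[of "X k - X l"] by (simp add: sums_iff)
          also have "\<dots> \<le> e\<^sup>2"
            using N[OF k that] by (intro power_mono) auto
          finally show ?thesis
            by (simp add: coord_minus)
        qed
        then show "\<exists>N. \<forall>l\<ge>N. (\<Sum>n<m. (norm (coord (X k) n - coord (X l) n))\<^sup>2) \<le> e\<^sup>2"
          by blast
      qed
      then have sm: "summable (\<lambda>n. (norm (coord (X k) n - L n))\<^sup>2)"
        by (intro summableI_nonneg_bounded) auto
      moreover have "(\<Sum>n. (norm (coord (X k) n - L n))\<^sup>2) \<le> e\<^sup>2"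
        using suminf_le_const[OF sm] part by blast
      ultimately show ?thesis
        using e by (simp add: l2_def l2norm_def real_sqrt_le_iff' real_le_lsqrt)
    qed
    then show ?thesis
      by blast
  qed
  obtain k where "(\<lambda>n. coord (X k) n - L n) \<in> l2"
    using tail[of 1] by auto
  then have "(\<lambda>n. coord (X k) n - (coord (X k) n - L n)) \<in> l2"
    by (rule l2_diff[OF coord])
  then have Ll2: "L \<in> l2"
    by simp
  have "X \<longlonglongrightarrow> Abs_ell2 L"
  proof (rule metric_LIMSEQ_I)
    fix e :: real assume "e > 0"
    then obtain N where N: "\<And>k. k \<ge> N \<Longrightarrow> l2norm (\<lambda>n. coord (X k) n - L n) \<le> e / 2"
      using tail[of "e / 2"] by auto
    have "coord (X k - Abs_ell2 L) = (\<lambda>n. coord (X k) n - L n)" for k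
      by (simp add: fun_eq_iff coord_minus coord_Abs_ell2[OF Ll2])
    then have "dist (X k) (Abs_ell2 L) < e" if "k \<ge> N" for k
      using N[OF that] \<open>e > 0\<close> by (simp add: dist_norm norm_ell2_def)
    then show "\<exists>N. \<forall>k\<ge>N. dist (X k) (Abs_ell2 L) < e"
      by blast
  qed
  then show "convergent X"
    by (auto simp: convergent_def)
qed

section \<open>Isometries\<close>

definition cisometry :: "('a::complex_inner \<Rightarrow> 'b::complex_inner) \<Rightarrow> bool" where
  "cisometry f \<longleftrightarrow> clinear f \<and> (\<forall>x. norm (f x) = norm x)"

lemma cisometry_clinear: "cisometry f \<Longrightarrow> clinear f"
  by (simp add: cisometry_def)

lemma cisometry_norm: "cisometry f \<Longrightarrow> norm (f x) = norm x"
  by (simp add: cisometry_def)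

lemma cisometryI_square:
  assumes "clinear f" "\<And>x. (norm (f x))\<^sup>2 = (norm x)\<^sup>2"
  shows "cisometry f"
  using assms by (simp add: cisometry_def power2_eq_iff_nonneg)

lemma cisometry_compose: "cisometry f \<Longrightarrow> cisometry g \<Longrightarrow> cisometry (\<lambda>x. f (g x))"
  by (simp add: cisometry_def clinear_compose)

lemma cisometry_inj:
  assumes "cisometry f"
  shows "inj f"
proof (rule injI)
  fix x y assume "f x = f y"
  then have "f (x - y) = 0"
    by (simp add: clinear_diff[OF cisometry_clinear[OF assms]])
  then have "norm (x - y) = 0"
    using cisometry_norm[OF assms, of "x - y"] by simp
  then show "x = y"
    by simp
qed

lemma clinear_Pair: "clinear f \<Longrightarrow> clinear g \<Longrightarrow> clinear (\<lambda>x. (f x, g x))"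
  by (simp add: clinear_def scaleC_Pair)

lemma clinear_fst: "clinear f \<Longrightarrow> clinear (\<lambda>x. fst (f x))"
  and clinear_snd: "clinear f \<Longrightarrow> clinear (\<lambda>x. snd (f x))"
  by (simp_all add: clinear_def)

lemma clinear_ident: "clinear (\<lambda>x. x)"
  by (simp add: clinear_def)

lemma cisometry_cinner:
  assumes "cisometry f"
  shows "cinner (f x) (f y) = cinner x y"
  by (rule cinner_eq_of_norm_eq[OF cisometry_clinear[OF assms] clinear_ident cisometry_norm[OF assms]])

lemma clinear_scaleC_left: "clinear f \<Longrightarrow> clinear (\<lambda>x. scaleC c (f x))"
  by (simp add: clinear_def scaleC_add_right scaleC_scaleC mult.commute)

lemma clinear_coord: "clinear f \<Longrightarrow> clinear (\<lambda>x. coord (f x) n)"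
  by (simp add: clinear_def coord_plus coord_scaleC)

lemmas clinear_intros = clinear_ident clinear_Pair clinear_fst clinear_snd clinear_scaleC_left
  clinear_coord

lemma clinear_Abs_ell2:
  assumes "\<And>x. f x \<in> l2" "\<And>n. clinear (\<lambda>x. f x n)"
  shows "clinear (\<lambda>x. Abs_ell2 (f x))"
  by (rule clinearI; rule ell2_eqI)
    (simp_all add: coord_plus coord_scaleC coord_Abs_ell2 assms(1) clinear_add[OF assms(2)]
      clinear_scaleC[OF assms(2)])

text \<open>The common criterion for the maps below: one \<open>sums\<close> identity gives both
  square-summability of the image and preservation of the norm.\<close>

lemma cisometry_Abs_ell2:
  assumes "\<And>x. (\<lambda>n. (norm (f x n))\<^sup>2) sums (norm x)\<^sup>2" "\<And>n. clinear (\<lambda>x. f x n)"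
  shows "cisometry (\<lambda>x. Abs_ell2 (f x))"
  by (rule cisometryI_square[OF clinear_Abs_ell2[OF l2_I[OF assms(1)] assms(2)] norm_Abs_ell2[OF assms(1)]])

section \<open>Isometries and unitary identifications of sequence spaces\<close>

lemma l2_reindex:
  assumes "x \<in> l2" "inj g"
  shows "(\<lambda>n. x (g n)) \<in> l2"
proof -
  have "(\<lambda>n. (norm (x n))\<^sup>2) summable_on UNIV"
    using assms(1) by (intro summable_nonneg_imp_summable_on) (auto simp: l2_def)
  then have "(\<lambda>n. (norm (x n))\<^sup>2) summable_on range g"
    by (rule summable_on_subset_banach) simp
  then have "((\<lambda>n. (norm (x n))\<^sup>2) \<circ> g) summable_on UNIV"
    by (simp add: summable_on_reindex[OF assms(2)])
  then show ?thesis
    unfolding l2_def mem_Collect_eq comp_def by (rule summable_on_imp_summable)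
qed

definition ell2_cons :: "'a \<times> 'a ell2 \<Rightarrow> 'a::complex_inner ell2" where
  "ell2_cons p = Abs_ell2 (case_nat (fst p) (coord (snd p)))"

lemma ell2_cons_sums:
  "(\<lambda>n. (norm (case_nat (fst p) (coord (snd p)) n))\<^sup>2) sums (norm (p :: 'a::complex_inner \<times> 'a ell2))\<^sup>2"
proof -
  have "(\<lambda>n. (norm (case_nat (fst p) (coord (snd p)) (Suc n)))\<^sup>2) sums (norm (snd p))\<^sup>2"
    using ell2_norm_sums[of "snd p"] by simp
  from sums_Suc[OF this] show ?thesis
    by (simp add: norm_prod_square add.commute)
qed

lemma coord_ell2_cons: "coord (ell2_cons p) n = case_nat (fst p) (coord (snd p)) n"
  by (simp add: ell2_cons_def coord_Abs_ell2[OF l2_I[OF ell2_cons_sums]])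

lemma cisometry_ell2_cons: "cisometry ell2_cons"
  unfolding ell2_cons_def
proof (rule cisometry_Abs_ell2[OF ell2_cons_sums])
  show "clinear (\<lambda>x :: 'a \<times> 'a ell2. case_nat (fst x) (coord (snd x)) n)" for n
    by (cases n) (auto intro!: clinear_intros)
qed

lemma surj_ell2_cons: "surj ell2_cons"
proof (rule surjI)
  fix z :: "'a ell2"
  have "(\<lambda>n. coord z (Suc n)) \<in> l2"
    by (rule l2_reindex) (auto simp: coord)
  then show "ell2_cons (coord z 0, Abs_ell2 (\<lambda>n. coord z (Suc n))) = z"
    by (intro ell2_eqI) (simp add: coord_ell2_cons coord_Abs_ell2 split: nat.split)
qed

definition ell2_interleave :: "'a ell2 \<times> 'a ell2 \<Rightarrow> 'a::complex_inner ell2" where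
  "ell2_interleave p =
     Abs_ell2 (\<lambda>n. if even n then coord (fst p) (n div 2) else coord (snd p) (n div 2))"

lemma ell2_interleave_sums:
  "(\<lambda>n. (norm (if even n then coord (fst p) (n div 2) else coord (snd p) (n div 2)))\<^sup>2)
     sums (norm (p :: 'a::complex_inner ell2 \<times> 'a ell2))\<^sup>2"
proof -
  have "(\<lambda>n. if even n then (norm (coord (fst p) (n div 2)))\<^sup>2
      else (norm (coord (snd p) ((n - 1) div 2)))\<^sup>2) sums (norm p)\<^sup>2"
    using sums_if[OF ell2_norm_sums[of "snd p"] ell2_norm_sums[of "fst p"]]
    by (simp add: norm_prod_square add.commute)
  \<comment> \<open>\<open>sums_if\<close> counts the odd places by \<open>(n - 1) div 2\<close>,
    whereas \<open>ell2_interleave\<close> uses \<open>n div 2\<close> at every place.\<close>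
  moreover have "(n - 1) div 2 = n div 2" if "odd n" for n :: nat
    using that by presburger
  ultimately show ?thesis
    by (auto elim!: back_subst[of "\<lambda>f. f sums _"] simp: fun_eq_iff)
qed

lemma cisometry_ell2_interleave: "cisometry ell2_interleave"
  unfolding ell2_interleave_def
proof (rule cisometry_Abs_ell2[OF ell2_interleave_sums])
  show "clinear (\<lambda>x :: 'a ell2 \<times> 'a ell2.
      if even n then coord (fst x) (n div 2) else coord (snd x) (n div 2))" for n
    by (cases "even n") (auto intro!: clinear_intros)
qed

lemma surj_ell2_interleave: "surj ell2_interleave"
proof (rule surjI)
  fix z :: "'a ell2"
  have "(\<lambda>n. coord z (2 * n)) \<in> l2" "(\<lambda>n. coord z (Suc (2 * n))) \<in> l2"
    by (rule l2_reindex, auto simp: coord inj_on_def)+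
  then show "ell2_interleave (Abs_ell2 (\<lambda>n. coord z (2 * n)), Abs_ell2 (\<lambda>n. coord z (Suc (2 * n)))) = z"
    by (intro ell2_eqI)
      (simp add: ell2_interleave_def coord_Abs_ell2 l2_I[OF ell2_interleave_sums])
qed

text \<open>Tonelli for nonnegative terms: the row sums give absolute summability over the product,
  where the unordered total must agree with the sum of the rows, and unordered sums are insensitive
  to the enumeration.\<close>

lemma sums_prod_decode:
  fixes f :: "nat \<times> nat \<Rightarrow> real"
  assumes nonneg: "\<And>p. f p \<ge> 0" and rows: "\<And>m. (\<lambda>j. f (m, j)) sums a m" and "a sums s"
  shows "(\<lambda>k. f (prod_decode k)) sums s"
proof -
  have a_nonneg: "a m \<ge> 0" for m
    using rows[of m] nonneg by (metis sums_iff suminf_nonneg)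
  have rows': "((\<lambda>j. f (m, j)) has_sum a m) UNIV" for m
    using rows nonneg by (rule sums_nonneg_imp_has_sum)
  have a: "(a has_sum s) UNIV"
    using assms(3) a_nonneg by (rule sums_nonneg_imp_has_sum)
  have "(\<lambda>p. norm (f p)) summable_on UNIV \<times> UNIV"
    unfolding Infinite_Sum.abs_summable_on_Sigma_iff
    using has_sum_imp_summable[OF rows'] has_sum_imp_summable[OF a] nonneg a_nonneg
    by (simp add: infsumI[OF rows'])
  then have "f summable_on UNIV \<times> UNIV"
    by (rule abs_summable_summable)
  then have f: "(f has_sum infsum f (UNIV \<times> UNIV)) (UNIV \<times> UNIV)"
    by (rule has_sum_infsum)
  have "(a has_sum infsum f (UNIV \<times> UNIV)) UNIV"
    using isUCont_plus f rows' by (rule has_sum_Sigma)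
  then have "infsum f (UNIV \<times> UNIV) = s"
    using a has_sum_unique by blast
  then have "(f has_sum s) (range prod_decode)"
    using f by (simp add: surj_prod_decode)
  then have "((f \<circ> prod_decode) has_sum s) UNIV"
    by (simp add: has_sum_reindex[OF inj_prod_decode])
  then show ?thesis
    using has_sum_imp_sums by (simp add: comp_def)
qed

definition ell2_flatten :: "'a ell2 ell2 \<Rightarrow> 'a::complex_inner ell2" where
  "ell2_flatten x = Abs_ell2 (\<lambda>k. coord (coord x (fst (prod_decode k))) (snd (prod_decode k)))"

lemma ell2_flatten_sums:
  "(\<lambda>k. (norm (coord (coord x (fst (prod_decode k))) (snd (prod_decode k))))\<^sup>2)
     sums (norm (x :: 'a::complex_inner ell2 ell2))\<^sup>2"
  by (rule sums_prod_decode[where f = "\<lambda>p. (norm (coord (coord x (fst p)) (snd p)))\<^sup>2"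
        and a = "\<lambda>m. (norm (coord x m))\<^sup>2"]) (simp_all add: ell2_norm_sums)

lemma coord_ell2_flatten:
  "coord (ell2_flatten x) k = coord (coord x (fst (prod_decode k))) (snd (prod_decode k))"
  by (simp add: ell2_flatten_def coord_Abs_ell2[OF l2_I[OF ell2_flatten_sums]])

lemma cisometry_ell2_flatten: "cisometry ell2_flatten"
  unfolding ell2_flatten_def
  by (rule cisometry_Abs_ell2[OF ell2_flatten_sums]) (intro clinear_intros)

lemma surj_ell2_flatten: "surj ell2_flatten"
proof (rule surjI)
  fix z :: "'a ell2"
  define r where "r m = Abs_ell2 (\<lambda>j. coord z (prod_encode (m, j)))" for m
  have "(\<lambda>j. coord z (prod_encode (m, j))) \<in> l2" for m
    by (rule l2_reindex) (auto simp: coord inj_on_def)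
  then have r: "coord (r m) j = coord z (prod_encode (m, j))" for m j
    by (simp add: r_def coord_Abs_ell2)
  \<comment> \<open>Tonelli in the other direction: cutting the single sequence \<open>z\<close>
    into rows \<open>r m\<close>, the squared row norms add up to the squared norm of
    \<open>z\<close>, so the sequence of rows is itself square-summable.\<close>
  define f where "f p = (norm (coord z (prod_encode p)))\<^sup>2" for p
  have "((f \<circ> prod_decode) has_sum (norm z)\<^sup>2) UNIV"
    using ell2_norm_sums[of z] by (auto simp: f_def comp_def intro!: sums_nonneg_imp_has_sum)
  then have "(f has_sum (norm z)\<^sup>2) (UNIV \<times> UNIV)"
    by (simp add: has_sum_reindex[OF inj_prod_decode, symmetric] surj_prod_decode)
  moreover have "((\<lambda>j. f (m, j)) has_sum (norm (r m))\<^sup>2) UNIV" for m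
    using ell2_norm_sums[of "r m"] by (auto simp: r f_def intro!: sums_nonneg_imp_has_sum)
  ultimately have "((\<lambda>m. (norm (r m))\<^sup>2) has_sum (norm z)\<^sup>2) UNIV"
    by (rule has_sum_Sigma[OF isUCont_plus])
  then have "r \<in> l2"
    by (intro l2_I has_sum_imp_sums)
  then show "ell2_flatten (Abs_ell2 (\<lambda>m. Abs_ell2 (\<lambda>j. coord z (prod_encode (m, j))))) = z"
    unfolding r_def[symmetric]
    by (intro ell2_eqI)
      (simp add: coord_ell2_flatten coord_Abs_ell2 r)
qed

text \<open>The direct sum of the maps \<open>U n\<close>. The value is meaningful when the image
  sequence is square-summable, as it is for isometric \<open>U n\<close>.\<close>

definition ell2_map :: "(nat \<Rightarrow> 'a \<Rightarrow> 'b) \<Rightarrow> 'a::complex_inner ell2 \<Rightarrow> 'b::complex_inner ell2" where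
  "ell2_map U x = Abs_ell2 (\<lambda>n. U n (coord x n))"

lemma ell2_map_sums:
  assumes "\<And>n. cisometry (U n)"
  shows "(\<lambda>n. (norm (U n (coord x n)))\<^sup>2) sums (norm x)\<^sup>2"
  using ell2_norm_sums[of x] by (simp add: cisometry_norm[OF assms])

lemma coord_ell2_map:
  assumes "\<And>n. cisometry (U n)"
  shows "coord (ell2_map U x) n = U n (coord x n)"
  by (simp add: ell2_map_def coord_Abs_ell2[OF l2_I[OF ell2_map_sums[OF assms]]])

lemma cisometry_ell2_map:
  assumes "\<And>n. cisometry (U n)"
  shows "cisometry (ell2_map U)"
  unfolding ell2_map_def
  by (rule cisometry_Abs_ell2[OF ell2_map_sums[OF assms]])
    (intro clinear_compose[OF cisometry_clinear[OF assms]] clinear_intros)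

lemma surj_ell2_map:
  assumes U: "\<And>n. cisometry (U n)" and "\<And>n. surj (U n)"
  shows "surj (ell2_map U)"
proof (rule surjI)
  fix z
  have inv: "U n (inv (U n) y) = y" for n y
    by (rule surj_f_inv_f[OF assms(2)])
  have "norm (inv (U n) y) = norm y" for n y
    using cisometry_norm[OF U, of n "inv (U n) y"] by (simp add: inv)
  then have "(\<lambda>n. inv (U n) (coord z n)) \<in> l2"
    using ell2_norm_sums[of z] by (intro l2_I) auto
  then show "ell2_map U (Abs_ell2 (\<lambda>n. inv (U n) (coord z n))) = z"
    by (intro ell2_eqI) (simp add: coord_ell2_map[OF U] coord_Abs_ell2 inv)
qed

text \<open>Reading a sequence of pairs as the sequence of all its components in order, this
  prepends one entry.\<close>

definition pair_shift :: "'f \<times> ('f \<times> 'f) ell2 \<Rightarrow> ('f \<times> 'f::complex_inner) ell2" where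
  "pair_shift p =
     Abs_ell2 (\<lambda>n. (case_nat (fst p) (\<lambda>k. snd (coord (snd p) k)) n, fst (coord (snd p) n)))"

lemma pair_shift_sums:
  "(\<lambda>n. (norm (case_nat (fst p) (\<lambda>k. snd (coord (snd p) k)) n, fst (coord (snd p) n)))\<^sup>2)
     sums (norm (p :: 'f::complex_inner \<times> ('f \<times> 'f) ell2))\<^sup>2"
proof -
  let ?a = "\<lambda>n. (norm (fst (coord (snd p) n)))\<^sup>2" and ?b = "\<lambda>n. (norm (snd (coord (snd p) n)))\<^sup>2"
  have ab: "(\<lambda>n. ?a n + ?b n) sums (norm (snd p))\<^sup>2"
    using ell2_norm_sums[of "snd p"] by (simp add: norm_prod_square)
  have "summable ?a" "summable ?b"
    by (rule summable_comparison_test'[OF sums_summable[OF ab], of 0], simp)+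
  then have a: "?a sums suminf ?a" and b: "?b sums suminf ?b"
    by (simp_all add: summable_sums)
  have "(\<lambda>n. (norm (case_nat (fst p) (\<lambda>k. snd (coord (snd p) k)) n))\<^sup>2)
      sums (suminf ?b + (norm (fst p))\<^sup>2)"
    using b sums_Suc[of "\<lambda>n. (norm (case_nat (fst p) (\<lambda>k. snd (coord (snd p) k)) n))\<^sup>2"] by simp
  from sums_add[OF this a] have "(\<lambda>n. (norm (case_nat (fst p) (\<lambda>k. snd (coord (snd p) k)) n))\<^sup>2 + ?a n)
      sums ((norm (fst p))\<^sup>2 + (suminf ?a + suminf ?b))"
    by (simp add: algebra_simps)
  moreover have "suminf ?a + suminf ?b = (norm (snd p))\<^sup>2"
    using sums_unique2[OF sums_add[OF a b] ab] .
  ultimately show ?thesis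
    by (simp add: norm_prod_square)
qed

lemma coord_pair_shift:
  "coord (pair_shift p) n = (case_nat (fst p) (\<lambda>k. snd (coord (snd p) k)) n, fst (coord (snd p) n))"
  by (simp add: pair_shift_def coord_Abs_ell2[OF l2_I[OF pair_shift_sums]])

lemma cisometry_pair_shift: "cisometry pair_shift"
  unfolding pair_shift_def
proof (rule cisometry_Abs_ell2[OF pair_shift_sums])
  show "clinear (\<lambda>p :: 'a \<times> ('a \<times> 'a) ell2.
      (case_nat (fst p) (\<lambda>k. snd (coord (snd p) k)) n, fst (coord (snd p) n)))" for n
    by (cases n) (auto intro!: clinear_intros)
qed

text \<open>Two shifts by one entry make a shift by a whole pair, so the old pairs move on unbroken
  and the two new entries form the first pair.\<close>

lemma coord_pair_shift_pair_shift:
  "coord (pair_shift (f, pair_shift (g, x))) n = case_nat (f, g) (coord x) n"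
  by (cases n) (simp_all add: coord_pair_shift)

text \<open>The dilation is built on an orthogonal sum of the given space with sequences of pairs;
  this identifies that sum with plain sequences. Each pair is interleaved, the resulting sequence of
  sequences is flattened, and the remaining summand is put in front.\<close>

lemma ell2_unitary_exists:
  "\<exists>\<Phi> :: 'a \<times> ('a ell2 \<times> 'a ell2) ell2 \<Rightarrow> 'a::complex_inner ell2. cisometry \<Phi> \<and> surj \<Phi>"
proof -
  define F :: "('a ell2 \<times> 'a ell2) ell2 \<Rightarrow> 'a ell2" where
    "F x = ell2_flatten (ell2_map (\<lambda>n. ell2_interleave) x)" for x
  have F: "cisometry F"
    unfolding F_def
    by (intro cisometry_compose[OF cisometry_ell2_flatten] cisometry_ell2_map cisometry_ell2_interleave)
  have "surj (ell2_flatten \<circ> ell2_map (\<lambda>n. ell2_interleave :: _ \<Rightarrow> 'a ell2))"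
    by (intro comp_surj surj_ell2_flatten surj_ell2_map cisometry_ell2_interleave surj_ell2_interleave)
  then have surjF: "surj F"
    by (simp add: F_def[abs_def] comp_def)
  define P where "P p = (fst p, F (snd p))" for p :: "'a \<times> ('a ell2 \<times> 'a ell2) ell2"
  have P: "cisometry P"
  proof (rule cisometryI_square)
    show "clinear P"
      unfolding P_def by (intro clinear_intros clinear_compose[OF cisometry_clinear[OF F]])
  qed (simp add: P_def norm_prod_square cisometry_norm[OF F])
  have surjP: "surj P"
    by (rule surjI[of _ "\<lambda>p. (fst p, inv F (snd p))"]) (simp add: P_def surj_f_inv_f[OF surjF])
  have "surj (ell2_cons \<circ> P)"
    by (rule comp_surj[OF surjP surj_ell2_cons])
  moreover have "cisometry (ell2_cons \<circ> P)"
    unfolding comp_def by (rule cisometry_compose[OF cisometry_ell2_cons P])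
  ultimately show ?thesis
    by blast
qed

section \<open>Defect maps\<close>

primrec alternating_orbit :: "('a \<Rightarrow> 'a) \<Rightarrow> ('a \<Rightarrow> 'a) \<Rightarrow> 'a \<Rightarrow> nat \<Rightarrow> 'a" where
  "alternating_orbit T S h 0 = h"
| "alternating_orbit T S h (Suc k) = (if even k then T else S) (alternating_orbit T S h k)"

lemma adjoint_clinear:
  fixes T S :: "'a::complex_inner \<Rightarrow> 'a"
  assumes adj: "\<And>x y. cinner (T x) y = cinner x (S y)"
  shows "clinear S"
proof -
  have eqI: "u = v" if "\<And>x. cinner x u = cinner x v" for u v :: 'a
    using that[of "u - v"] cinner_eq_zero_iff[of "u - v"] by (simp add: cinner_diff_right)
  show ?thesis
  proof (rule clinearI)
    show "S (x + y) = S x + S y" for x y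
      by (rule eqI) (simp add: cinner_add_right adj[symmetric])
    show "S (scaleC c x) = scaleC c (S x)" for c x
      by (rule eqI) (simp add: cinner_scaleC_right adj[symmetric])
  qed
qed

text \<open>The square of \<open>norm (S y)\<close> is the inner product of \<open>T (S y)\<close>
  with \<open>y\<close>, hence at most \<open>norm (S y) * norm y\<close>; one factor
  cancels.\<close>

lemma adjoint_norm_le:
  fixes T S :: "'a::complex_inner \<Rightarrow> 'a"
  assumes adj: "\<And>x y. cinner (T x) y = cinner x (S y)" and T: "\<And>x. norm (T x) \<le> norm x"
  shows "norm (S y) \<le> norm y"
proof -
  have "(norm (S y))\<^sup>2 = Re (cinner (T (S y)) y)"
    by (simp add: adj Re_cinner_self)
  also have "\<dots> \<le> norm (T (S y)) * norm y"
    using complex_Re_le_cmod Cauchy_Schwarz_cinner order_trans by blast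
  also have "\<dots> \<le> norm (S y) * norm y"
    by (intro mult_right_mono T norm_ge_zero)
  finally have "norm (S y) * norm (S y) \<le> norm (S y) * norm y"
    by (simp add: power2_eq_square)
  then show ?thesis
    by (cases "S y = 0") simp_all
qed

text \<open>The usual defect operator is the square root of \<open>1 - T\<^sup>* T\<close>. Allowing values in a
  sequence space makes the square root unnecessary: for the orbit \<open>u 0 = h\<close>, \<open>u 1 = T h\<close>,
  \<open>u 2 = T\<^sup>* T h\<close>, ... the square of \<open>norm (u k - u (k + 2))\<close> is the second difference of the
  squares of \<open>norm (u k)\<close>, so that the sum over \<open>k\<close> telescopes.\<close>

lemma contraction_defect_exists:
  fixes T :: "'a::{complex_inner, complete_space} \<Rightarrow> 'a"
  assumes T: "contraction T"
  shows "\<exists>D :: 'a \<Rightarrow> 'a ell2. clinear D \<and> (\<forall>h. (norm (D h))\<^sup>2 = (norm h)\<^sup>2 - (norm (T h))\<^sup>2)"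
proof -
  obtain S where adj: "\<And>x y. cinner (T x) y = cinner x (S y)"
    using contraction_adjoint_exists[OF T] by blast
  have adj': "cinner (S x) y = cinner x (T y)" for x y
    using adj[of y x] cinner_commute[of "S x" y] cinner_commute[of x "T y"] by simp
  have linT: "clinear T"
    using T by (rule contraction_clinear)
  have linS: "clinear S"
    using adj by (rule adjoint_clinear)
  have normT: "norm (T x) \<le> norm x" for x
    using T by (rule contraction_norm_le)
  have normS: "norm (S x) \<le> norm x" for x
    using adj normT by (rule adjoint_norm_le)
  define u where "u = alternating_orbit T S"
  have lin: "clinear (\<lambda>h. u h k)" for k
  proof (induction k)
    case 0
    show ?case
      by (simp add: u_def clinear_ident)
  next
    case (Suc k)
    have "clinear (if even k then T else S)"
      using linT linS by simp
    from clinear_compose[OF this Suc] show ?case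
      by (simp add: u_def)
  qed
  have dec: "norm (u h (Suc k)) \<le> norm (u h k)" for h k
    by (simp add: u_def normT normS)
  \<comment> \<open>One map moves across the inner product: the step from \<open>u h (Suc k)\<close>
    to \<open>u h (Suc (Suc k))\<close> is the adjoint of the step from \<open>u h k\<close> to
    \<open>u h (Suc k)\<close>.\<close>
  have inner: "Re (cinner (u h k) (u h (Suc (Suc k)))) = (norm (u h (Suc k)))\<^sup>2" for h k
  proof -
    have "Re (cinner x (S (T x))) = (norm (T x))\<^sup>2" "Re (cinner x (T (S x))) = (norm (S x))\<^sup>2" for x
      using adj[of x "T x"] adj'[of x "S x"] Re_cinner_self[of "T x"] Re_cinner_self[of "S x"] by simp_all
    then show ?thesis
      by (simp add: u_def)
  qed
  have sums: "(\<lambda>k. (norm (u h k - u h (Suc (Suc k))))\<^sup>2) sums ((norm h)\<^sup>2 - (norm (T h))\<^sup>2)" for h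
  proof -
    define a where "a k = (norm (u h k))\<^sup>2" for k
    have "decseq a"
      unfolding decseq_Suc_iff a_def using dec by (simp add: power_mono)
    then obtain L where L: "a \<longlonglongrightarrow> L"
      using decseq_convergent[of a 0] by (auto simp: a_def)
    \<comment> \<open>The first differences of a convergent sequence tend to 0, so the second
      differences sum to the initial first difference \<open>a 0 - a (Suc 0)\<close>.\<close>
    have "(\<lambda>k. a k - a (Suc k)) \<longlonglongrightarrow> L - L"
      by (intro tendsto_diff L LIMSEQ_Suc)
    from telescope_sums'[OF this]
    have "(\<lambda>k. a k - a (Suc k) - (a (Suc k) - a (Suc (Suc k)))) sums (a 0 - a (Suc 0))"
      by simp
    moreover have "(norm (u h k - u h (Suc (Suc k))))\<^sup>2 = a k - a (Suc k) - (a (Suc k) - a (Suc (Suc k)))" for k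
      unfolding norm_diff_square inner a_def by simp
    ultimately show ?thesis
      by (simp add: a_def u_def)
  qed
  have "clinear (\<lambda>h. Abs_ell2 (\<lambda>k. u h k - u h (Suc (Suc k))))"
  proof (rule clinear_Abs_ell2)
    show "(\<lambda>k. u h k - u h (Suc (Suc k))) \<in> l2" for h
      using sums by (rule l2_I)
    show "clinear (\<lambda>h. u h k - u h (Suc (Suc k)))" for k
      by (rule clinearI)
        (simp_all add: clinear_add[OF lin] clinear_scaleC[OF lin] scaleC_diff_right)
  qed
  then show ?thesis
    using norm_Abs_ell2[OF sums] by blast
qed

section \<open>The dilation\<close>

text \<open>The construction on the model space, whose first coordinate is the given space. That
  \<open>fst (V1 k)\<close> and \<open>fst (V2 k)\<close> depend linearly on \<open>fst k\<close>
  alone encodes the lifting property: vectors with first coordinate 0 are preserved, and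
  compressions of words in \<open>V1\<close> and \<open>V2\<close> can be read off.\<close>

lemma isometric_dilation_exists:
  fixes T1 T2 Q :: "'a::complex_inner \<Rightarrow> 'a" and d1 d2 :: "'a \<Rightarrow> 'f::{complex_inner, complete_space}"
  assumes lin: "clinear T1" "clinear T2" "clinear d1" "clinear d2"
    and d1: "\<And>h. (norm (d1 h))\<^sup>2 = (norm h)\<^sup>2 - (norm (T1 h))\<^sup>2"
    and d2: "\<And>h. (norm (d2 h))\<^sup>2 = (norm h)\<^sup>2 - (norm (T2 h))\<^sup>2"
    and orth: "\<And>g h. cinner (d1 g) (d2 h) = 0"
    and Q: "\<And>h. norm (Q h) = norm h" and comm: "\<And>h. T2 (T1 h) = Q (T1 (T2 h))"
    and q: "cmod q = 1"
  shows "\<exists>V1 V2 :: 'a \<times> ('f \<times> 'f) ell2 \<Rightarrow> 'a \<times> ('f \<times> 'f) ell2.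
    cisometry V1 \<and> cisometry V2 \<and> (\<forall>k. fst (V1 k) = T1 (fst k)) \<and> (\<forall>k. fst (V2 k) = T2 (fst k)) \<and>
    (\<forall>k. V2 (V1 k) = (Q (fst (V1 (V2 k))), scaleC q (snd (V1 (V2 k)))))"
proof -
  have qq: "q * cnj q = 1" "cnj q * q = 1"
    using q by (simp_all add: complex_norm_square[symmetric] mult.commute[of "cnj q"])
  define A where "A h = (d1 (T2 h), d2 h)" for h
  define B where "B h = scaleC (cnj q) (d2 (T1 h), d1 h)" for h
  have linA: "clinear A"
    unfolding A_def by (intro clinear_Pair lin clinear_compose[OF lin(3)])
  have linB: "clinear B"
    unfolding B_def by (intro clinear_scaleC_left clinear_Pair lin clinear_compose[OF lin(4)])
  \<comment> \<open>The defects telescope: the two sides are \<open>(norm h)\<^sup>2\<close> minus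
    the squared norm of \<open>T1 (T2 h)\<close> and of \<open>T2 (T1 h)\<close> respectively, which
    agree because \<open>Q\<close> preserves norms.\<close>
  have "(norm (A h))\<^sup>2 = (norm (B h))\<^sup>2" for h
    using comm[of h] Q[of "T1 (T2 h)"]
    by (simp add: A_def B_def norm_prod_square norm_scaleC q d1 d2)
  then have normAB: "norm (A h) = norm (B h)" for h
    using power2_eq_iff_nonneg norm_ge_zero by blast
  have orthAB: "cinner (A g) (B h) = 0" for g h
    by (simp add: A_def B_def cinner_prod_def cinner_scaleC_right orth cinner_eq_zero_sym[OF orth])
  obtain G where linG: "clinear G" and normG: "\<And>z. norm (G z) = norm z"
    and GG: "\<And>z. G (G z) = z" and GA: "\<And>h. G (A h) = B h"
    using reflection_exists[OF linA linB normAB orthAB] by blast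
  have blockG: "cisometry (\<lambda>z. scaleC (c ^ n) (G z))" if "cmod c = 1" for c and n :: nat
    unfolding cisometry_def
    by (simp add: clinear_scaleC_left[OF linG] norm_scaleC normG norm_power that)
  \<comment> \<open>\<open>L (cnj q)\<close> is the unitary that modifies the first lifting. Since
    \<open>G\<close> is an involution, \<open>L q\<close> undoes it and serves as the inverse in the
    second.\<close>
  define L where "L c = ell2_map (\<lambda>n z. scaleC (c ^ n) (G z))" for c
  have L: "cisometry (L c)" if "cmod c = 1" for c
    unfolding L_def using blockG[OF that] by (rule cisometry_ell2_map)
  have coord_L: "coord (L c x) n = scaleC (c ^ n) (G (coord x n))" if "cmod c = 1" for c x n
    unfolding L_def using blockG[OF that] by (rule coord_ell2_map)
  have cq: "cmod (cnj q) = 1"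
    using q by simp
  have q_inv: "L q (L (cnj q) x) = x" for x
    by (rule ell2_eqI)
      (simp add: coord_L q clinear_scaleC[OF linG] GG scaleC_scaleC scaleC_one
        power_mult_distrib[symmetric] qq)
  define V1 where "V1 k = (T1 (fst k), L (cnj q) (pair_shift (d1 (fst k), snd k)))"
    for k :: "'a \<times> ('f \<times> 'f) ell2"
  define V2 where "V2 k = (T2 (fst k), pair_shift (d2 (fst k), L q (snd k)))"
    for k :: "'a \<times> ('f \<times> 'f) ell2"
  note lin_shift = clinear_compose[OF cisometry_clinear[OF cisometry_pair_shift]]
  have "cisometry V1"
  proof (rule cisometryI_square)
    show "clinear V1"
      unfolding V1_def
      by (rule clinear_Pair clinear_compose[OF lin(1)] clinear_compose[OF lin(3)] lin_shift
          clinear_compose[OF cisometry_clinear[OF L[OF cq]]] clinear_fst clinear_snd clinear_ident)+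
    show "(norm (V1 k))\<^sup>2 = (norm k)\<^sup>2" for k
      by (simp add: V1_def norm_prod_square[of "(_, _)"] norm_prod_square[of k]
          cisometry_norm[OF L[OF cq]] cisometry_norm[OF cisometry_pair_shift] d1)
  qed
  moreover have "cisometry V2"
  proof (rule cisometryI_square)
    show "clinear V2"
      unfolding V2_def
      by (rule clinear_Pair clinear_compose[OF lin(2)] clinear_compose[OF lin(4)] lin_shift
          clinear_compose[OF cisometry_clinear[OF L[OF q]]] clinear_fst clinear_snd clinear_ident)+
    show "(norm (V2 k))\<^sup>2 = (norm k)\<^sup>2" for k
      by (simp add: V2_def norm_prod_square[of "(_, _)"] norm_prod_square[of k]
          cisometry_norm[OF L[OF q]] cisometry_norm[OF cisometry_pair_shift] d2)
  qed
  moreover have "V2 (V1 k) = (Q (fst (V1 (V2 k))), scaleC q (snd (V1 (V2 k))))" for k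
  proof -
    obtain h x where k: "k = (h, x)"
      by (cases k)
    \<comment> \<open>In \<open>V2 (V1 k)\<close> the two factors \<open>L q\<close> and
      \<open>L (cnj q)\<close> meet and cancel; in \<open>V1 (V2 k)\<close> they stand on either
      side of the double shift. The new first pair is matched by the choice of \<open>G\<close>, the
      later pairs by the powers of \<open>q\<close>.\<close>
    have "pair_shift (d2 (T1 h), pair_shift (d1 h, x)) =
        scaleC q (L (cnj q) (pair_shift (d1 (T2 h), pair_shift (d2 h, L q x))))"
    proof (rule ell2_eqI)
      fix n
      show "coord (pair_shift (d2 (T1 h), pair_shift (d1 h, x))) n =
        coord (scaleC q (L (cnj q) (pair_shift (d1 (T2 h), pair_shift (d2 h, L q x))))) n"
      proof (cases n)
        case 0
        have "G (d1 (T2 h), d2 h) = scaleC (cnj q) (d2 (T1 h), d1 h)"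
          using GA[of h] by (simp add: A_def B_def)
        then show ?thesis
          by (simp add: 0 coord_pair_shift_pair_shift coord_scaleC coord_L[OF cq] scaleC_one
              scaleC_scaleC qq del: complex_cnj_power)
      next
        case (Suc m)
        \<comment> \<open>\<open>L q\<close> meets this pair at position \<open>m\<close> and
          \<open>L (cnj q)\<close> meets it after the shift at position \<open>Suc m\<close>; the
          outer factor \<open>q\<close> makes up for the difference in exponents.\<close>
        have "q * (cnj q ^ Suc m * q ^ m) = (q * cnj q) * (cnj q * q) ^ m"
          by (simp add: power_mult_distrib mult_ac)
        then have "q * (cnj q ^ Suc m * q ^ m) = 1"
          by (simp add: qq)
        then show ?thesis
          by (simp add: Suc coord_pair_shift_pair_shift coord_scaleC coord_L[OF cq] coord_L[OF q]
              scaleC_one scaleC_scaleC clinear_scaleC[OF linG] GG mult.assoc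
              del: complex_cnj_power power_Suc)
      qed
    qed
    then show ?thesis
      by (simp add: k V1_def V2_def comm q_inv)
  qed
  ultimately show ?thesis
    by (intro exI[of _ V1] exI[of _ V2]) (simp add: V1_def V2_def)
qed

section \<open>Transport of the dilation to square-summable sequences\<close>

theorem mainTheorem2:
  fixes T1 T2 Q :: "'a::{complex_inner, complete_space} \<Rightarrow> 'a"
  assumes "contraction T1" and "contraction T2" and "unitary_op Q"
    and "T2 \<circ> T1 = Q \<circ> T1 \<circ> T2"
  shows "\<forall>q. cmod q = 1 \<longrightarrow>
    (\<exists>(K :: (nat \<Rightarrow> 'a) set) J V1 V2 Qbar.
       closed_subspace_l2 K \<and> embedding K J \<and>
       isometry_on K V1 \<and> isometry_on K V2 \<and> unitary_on K Qbar \<and>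
       Qbar ` (J ` UNIV) \<subseteq> J ` UNIV \<and> Qbar ` ocomp K J \<subseteq> ocomp K J \<and>
       (\<forall>h. Qbar (J h) = J (Q h)) \<and>
       (\<forall>k\<in>ocomp K J. Qbar k = (\<lambda>n. scaleC q (k n))) \<and>
       (\<forall>k\<in>K. V2 (V1 k) = Qbar (V1 (V2 k))) \<and>
       lifting K J V1 T1 \<and> lifting K J V2 T2 \<and>
       (\<forall>n m. compr_eq K J ((V1 ^^ n) \<circ> (V2 ^^ m)) ((T1 ^^ n) \<circ> (T2 ^^ m))) \<and>
       (\<forall>n m. compr_eq K J ((V2 ^^ n) \<circ> (V1 ^^ m)) ((T2 ^^ n) \<circ> (T1 ^^ m))))"
proof (intro allI impI)
  fix q :: complex
  assume q: "cmod q = 1"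
  have comm: "T2 (T1 h) = Q (T1 (T2 h))" for h
    using fun_cong[OF assms(4), of h] by simp
  have linT: "clinear T1" "clinear T2"
    using assms(1,2) by (simp_all add: contraction_clinear)
  have Q: "clinear Q" "\<And>x. norm (Q x) = norm x" "surj Q"
    using assms(3) by (auto simp: unitary_op_def bounded_op_def clinear_def linear_add bounded_linear.linear)
  obtain D1 D2 :: "'a \<Rightarrow> 'a ell2" where D: "clinear D1" "clinear D2"
    "\<And>h. (norm (D1 h))\<^sup>2 = (norm h)\<^sup>2 - (norm (T1 h))\<^sup>2" "\<And>h. (norm (D2 h))\<^sup>2 = (norm h)\<^sup>2 - (norm (T2 h))\<^sup>2"
    using contraction_defect_exists[OF assms(1)] contraction_defect_exists[OF assms(2)] by blast
  \<comment> \<open>Placing the two defect maps on even and on odd positions makes their ranges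
    orthogonal inside the same sequence space.\<close>
  define d1 d2 where "d1 h = ell2_interleave (D1 h, 0)" and "d2 h = ell2_interleave (0, D2 h)" for h
  have lin0: "clinear (\<lambda>h. 0)"
    by (simp add: clinear_def)
  note interleave = cisometry_ell2_interleave
  have lind: "clinear d1" "clinear d2"
    unfolding d1_def d2_def
    by (intro clinear_compose[OF cisometry_clinear[OF interleave]] clinear_Pair D lin0)+
  have d1: "(norm (d1 h))\<^sup>2 = (norm h)\<^sup>2 - (norm (T1 h))\<^sup>2"
    and d2: "(norm (d2 h))\<^sup>2 = (norm h)\<^sup>2 - (norm (T2 h))\<^sup>2" for h
    by (simp_all add: d1_def d2_def cisometry_norm[OF interleave] norm_prod_square[of "(_, _)"] D(3,4))
  have orth: "cinner (d1 g) (d2 h) = 0" for g h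
    by (simp add: d1_def d2_def cisometry_cinner[OF interleave] cinner_prod_def)
  obtain V1 V2 :: "'a \<times> ('a ell2 \<times> 'a ell2) ell2 \<Rightarrow> 'a \<times> ('a ell2 \<times> 'a ell2) ell2"
    where V: "cisometry V1" "cisometry V2"
      and fstV: "\<And>k. fst (V1 k) = T1 (fst k)" "\<And>k. fst (V2 k) = T2 (fst k)"
      and VV: "\<And>k. V2 (V1 k) = (Q (fst (V1 (V2 k))), scaleC q (snd (V1 (V2 k))))"
    using isometric_dilation_exists[where ?d1.0 = d1 and ?d2.0 = d2 and Q = Q,
        OF linT lind d1 d2 orth Q(2) comm q] by blast
  define U where "U k = (Q (fst k), scaleC q (snd k))" for k :: "'a \<times> ('a ell2 \<times> 'a ell2) ell2"
  have isoU: "cisometry U"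
  proof (rule cisometryI_square)
    show "clinear U"
      unfolding U_def by (intro clinear_intros clinear_compose[OF Q(1)])
    show "(norm (U k))\<^sup>2 = (norm k)\<^sup>2" for k
      by (simp add: U_def norm_prod_square[of "(_, _)"] norm_prod_square[of k] Q(2) norm_scaleC q)
  qed
  have surjU: "surj U"
  proof (rule surjI)
    fix k :: "'a \<times> ('a ell2 \<times> 'a ell2) ell2"
    have "q * cnj q = 1"
      using q by (simp add: complex_norm_square[symmetric])
    then show "U (inv Q (fst k), scaleC (cnj q) (snd k)) = k"
      by (simp add: U_def surj_f_inv_f[OF Q(3)] scaleC_scaleC scaleC_one)
  qed
  obtain \<Phi> :: "'a \<times> ('a ell2 \<times> 'a ell2) ell2 \<Rightarrow> 'a ell2" where \<Phi>: "cisometry \<Phi>" "surj \<Phi>"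
    using ell2_unitary_exists by blast
  \<comment> \<open>\<open>R\<close> identifies the model space with \<open>l2\<close>, and
    \<open>lift V\<close> is the conjugate of \<open>V\<close> under it, meaningful on
    \<open>l2\<close> only.\<close>
  define R where "R k = coord (\<Phi> k)" for k
  define lift where "lift V f = R (V (inv \<Phi> (Abs_ell2 f)))" for V f
  have lift: "lift V (R k) = R (V k)" for V k
    by (simp add: lift_def R_def coord_inverse inv_f_f[OF cisometry_inj[OF \<Phi>(1)]])
  have R_l2: "R k \<in> l2" for k
    by (simp add: R_def coord)
  have R_cases: "\<exists>k. f = R k" if "f \<in> l2" for f
    using that surjD[OF \<Phi>(2), of "Abs_ell2 f"] by (metis R_def coord_Abs_ell2)
  have R_add: "(\<lambda>n. R k n + R k' n) = R (k + k')" for k k'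
    by (simp add: R_def clinear_add[OF cisometry_clinear[OF \<Phi>(1)]] coord_plus fun_eq_iff)
  have R_scaleC: "(\<lambda>n. scaleC c (R k n)) = R (scaleC c k)" for c k
    by (simp add: R_def clinear_scaleC[OF cisometry_clinear[OF \<Phi>(1)]] coord_scaleC fun_eq_iff)
  have R_inner: "l2inner (R k) (R k') = cinner k k'" for k k'
    unfolding R_def cinner_ell2_def[symmetric] by (rule cisometry_cinner[OF \<Phi>(1)])
  have R_norm: "l2norm (R k) = norm k" for k
    unfolding R_def norm_ell2_def[symmetric] by (rule cisometry_norm[OF \<Phi>(1)])
  define J where "J h = R (h, 0)" for h
  have R_J: "l2inner (R k) (J h) = cinner (fst k) h" for k h
    by (simp add: J_def R_inner cinner_prod_def)
  have ocomp_l2: "ocomp l2 J \<subseteq> l2"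
    by (auto simp: ocomp_def)
  \<comment> \<open>The complement of the embedded space consists of the vectors with vanishing
    first coordinate, so its invariance can be checked on \<open>fst\<close>.\<close>
  have R_ocomp: "R k \<in> ocomp l2 J \<longleftrightarrow> fst k = 0" for k
    using cinner_eq_zero_iff[of "fst k"] by (auto simp: ocomp_def R_l2 R_J)
  have iso_lift: "isometry_on l2 (lift V)" if V: "cisometry V" for V
    unfolding isometry_on_def linear_on_def
    using clinear_add[OF cisometry_clinear[OF V]] clinear_scaleC[OF cisometry_clinear[OF V]]
      cisometry_norm[OF V]
    by (auto dest!: R_cases simp: lift R_add R_scaleC R_l2 R_norm)
  have lift_ocomp: "lift V ` ocomp l2 J \<subseteq> ocomp l2 J" if "\<And>k. fst k = 0 \<Longrightarrow> fst (V k) = 0" for V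
  proof
    fix f assume "f \<in> lift V ` ocomp l2 J"
    then obtain g where g: "g \<in> ocomp l2 J" "f = lift V g"
      by blast
    then obtain k where "g = R k"
      using R_cases ocomp_l2 by blast
    then show "f \<in> ocomp l2 J"
      using g that by (simp add: lift R_ocomp)
  qed
  have lift_power: "(lift V ^^ n) (R k) = R ((V ^^ n) k)" for V n k
    by (induction n) (simp_all add: lift)
  have fst_power: "fst ((V ^^ n) k) = (T ^^ n) (fst k)" if "\<And>k. fst (V k) = T (fst k)"
    for V :: "'a \<times> ('a ell2 \<times> 'a ell2) ell2 \<Rightarrow> 'a \<times> ('a ell2 \<times> 'a ell2) ell2" and T n k
    by (induction n) (simp_all add: that)
  \<comment> \<open>Pairing with \<open>J h'\<close> sees only the first coordinate, on which
    \<open>V\<close> and \<open>W\<close> act as \<open>T\<close> and \<open>S\<close>; the identity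
    for powers follows by iteration.\<close>
  have compr: "compr_eq l2 J ((lift V ^^ n) \<circ> (lift W ^^ m)) ((T ^^ n) \<circ> (S ^^ m))"
    if "\<And>k. fst (V k) = T (fst k)" "\<And>k. fst (W k) = S (fst k)" for V W T S n m
    unfolding compr_eq_def
    by (simp add: J_def[of "_"] lift_power R_J[unfolded J_def] fst_power[of V T, OF that(1)]
        fst_power[of W S, OF that(2)])
  \<comment> \<open>The compression identity is the case of exponents 1 and 0; invariance of the
    complement follows from \<open>T 0 = 0\<close>.\<close>
  have lifts: "lifting l2 J (lift V) T" if "\<And>k. fst (V k) = T (fst k)" "clinear T" for V T
    unfolding lifting_def
    using lift_ocomp[of V] compr[of V T V T 1 0, OF that(1) that(1)] that clinear_zero[OF that(2)]
    by simp
  have surj_lift: "lift U ` l2 = l2"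
  proof
    show "lift U ` l2 \<subseteq> l2"
      using iso_lift[OF isoU] by (simp add: isometry_on_def linear_on_def)
    show "l2 \<subseteq> lift U ` l2"
    proof
      fix f :: "nat \<Rightarrow> 'a" assume "f \<in> l2"
      then obtain k where "f = R k"
        using R_cases by blast
      moreover obtain k' where "k = U k'"
        using surjU by (rule surjE)
      ultimately show "f \<in> lift U ` l2"
        using R_l2 lift[of U k'] by (metis imageI)
    qed
  qed
  have U_J: "lift U (J h) = J (Q h)" for h
    by (simp add: J_def lift U_def)
  have U_ocomp: "lift U f = (\<lambda>n. scaleC q (f n))" if f: "f \<in> ocomp l2 J" for f
  proof -
    obtain k where k: "f = R k"
      using R_cases ocomp_l2 f by blast
    then have "U k = scaleC q k"
      using f clinear_zero[OF Q(1)] by (simp add: R_ocomp U_def prod_eq_iff)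
    then show ?thesis
      by (simp add: k lift R_scaleC)
  qed
  \<comment> \<open>The dilation space is taken to be all of \<open>l2\<close>, so closedness under
    limits in \<open>l2\<close> is immediate.\<close>
  have closed: "closed_subspace_l2 (l2 :: (nat \<Rightarrow> 'a) set)"
    by (simp add: closed_subspace_l2_def l2_zero l2_add l2_scaleC)
  have emb: "embedding l2 J"
    by (auto simp: embedding_def J_def R_l2 R_add R_scaleC R_inner cinner_prod_def scaleC_Pair)
  have twist: "lift V2 (lift V1 f) = lift U (lift V1 (lift V2 f))" if "f \<in> l2" for f
    using R_cases[OF that] VV by (auto simp: lift U_def)
  show "\<exists>K J V1 V2 Qbar.
       closed_subspace_l2 K \<and> embedding K J \<and>
       isometry_on K V1 \<and> isometry_on K V2 \<and> unitary_on K Qbar \<and>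
       Qbar ` (J ` UNIV) \<subseteq> J ` UNIV \<and> Qbar ` ocomp K J \<subseteq> ocomp K J \<and>
       (\<forall>h. Qbar (J h) = J (Q h)) \<and>
       (\<forall>k\<in>ocomp K J. Qbar k = (\<lambda>n. scaleC q (k n))) \<and>
       (\<forall>k\<in>K. V2 (V1 k) = Qbar (V1 (V2 k))) \<and>
       lifting K J V1 T1 \<and> lifting K J V2 T2 \<and>
       (\<forall>n m. compr_eq K J ((V1 ^^ n) \<circ> (V2 ^^ m)) ((T1 ^^ n) \<circ> (T2 ^^ m))) \<and>
       (\<forall>n m. compr_eq K J ((V2 ^^ n) \<circ> (V1 ^^ m)) ((T2 ^^ n) \<circ> (T1 ^^ m)))"
  proof (rule exI[of _ l2], rule exI[of _ J], rule exI[of _ "lift V1"], rule exI[of _ "lift V2"],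
      rule exI[of _ "lift U"], intro conjI allI ballI)
    show "unitary_on l2 (lift U)"
      using iso_lift[OF isoU] surj_lift by (simp add: unitary_on_def)
    show "lift U ` J ` UNIV \<subseteq> J ` UNIV"
      using U_J by auto
    show "lift U ` ocomp l2 J \<subseteq> ocomp l2 J"
      by (rule lift_ocomp) (simp add: U_def clinear_zero[OF Q(1)])
  qed (simp_all add: closed emb iso_lift V U_J U_ocomp twist lifts fstV linT compr)
qed

end
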